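(* Algorithm CleverGreedy is deterministic and, given as input a graph $G=(V,E)$ with $m$ edges, maximum degree $\Delta$ and arboricity $\alpha$, returns a proper $(\Delta+2\alpha-1)$-edge coloring of $G$ (i.e., a proper edge coloring with colors in $\{1,\dots,\Delta+2\alpha-1\}$), and it can be implemented to run in $O(m\log^2\Delta)$ time.
   Context: A proper edge coloring assigns colors to edges so that edges sharing an endpoint receive different colors. The arboricity of $G$ is the smallest integer $\alpha$ with $\lceil|E(G[S])|/(|S|-1)\rceil\le\alpha$ for all $S\subseteq V$, $|S|\ge 2$. For a graph $H$ and edge $(u,v)$ of $H$, let $\Phi_H(u,v)=\min\{\deg_H(u),\deg_H(v)\}$, and $N_H(e)$ denote the set of edges of $H$ sharing an endpoint with $e$. Algorithm CleverGreedy$(G)$: Phase I: set $G_1=G$; for $i=1,\dots,m$, let $e_i$ be an edge of $G_i$ minimizing $\Phi_{G_i}$ and set $G_{i+1}=G_i-e_i$. Phase II: start with all edges uncolored; for $i=m,m-1,\dots,1$, writing $e_i=(u_i,v_i)$, assign to $e_i$ any color in $\{1,\dots,\deg_{G_i}(u_i)+\deg_{G_i}(v_i)-1\}\setminus\chi(N_{G_{i+1}}(e_i))$, where $\chi(F)$ is the set of colors currently assigned to edges of $F$. Return the coloring $\chi$. *)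

theory Defs
  imports Complex_Main
begin

section \<open>Graphs and edge colorings\<close>

text \<open>A graph is a vertex set together with a set of two-element vertex sets. Most notions depend
  on the edge set only.\<close>

definition simple_graph :: "'a set \<Rightarrow> 'a set set \<Rightarrow> bool" where
  "simple_graph V E \<longleftrightarrow> finite V \<and> (\<forall>e\<in>E. e \<subseteq> V \<and> card e = 2)"

definition degree :: "'a set set \<Rightarrow> 'a \<Rightarrow> nat" where
  "degree E v = card {e \<in> E. v \<in> e}"

text \<open>The value 0 is inserted only so that the graph without vertices has maximum degree 0.\<close>

definition max_degree :: "'a set \<Rightarrow> 'a set set \<Rightarrow> nat" where
  "max_degree V E = Max (insert 0 (degree E ` V))"

definition induced_edges :: "'a set set \<Rightarrow> 'a set \<Rightarrow> 'a set set" where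
  "induced_edges E S = {e \<in> E. e \<subseteq> S}"

definition arboricity :: "'a set \<Rightarrow> 'a set set \<Rightarrow> nat" where
  "arboricity V E = (LEAST a. \<forall>S \<subseteq> V. card S \<ge> 2 \<longrightarrow>
     \<lceil>real (card (induced_edges E S)) / (real (card S) - 1)\<rceil> \<le> int a)"

text \<open>For an edge \<open>e = {u, v}\<close> this is the minimum of the degrees of \<open>u\<close> and \<open>v\<close>.\<close>

definition edge_weight :: "'a set set \<Rightarrow> 'a set \<Rightarrow> nat" ("\<Phi>") where
  "\<Phi> H e = Min (degree H ` e)"

definition edge_nbhd :: "'a set set \<Rightarrow> 'a set \<Rightarrow> 'a set set" where
  "edge_nbhd H e = {f \<in> H. f \<noteq> e \<and> f \<inter> e \<noteq> {}}"

text \<open>A partial coloring maps an edge to \<^term>\<open>None\<close> while it is uncolored.\<close>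

type_synonym 'a coloring = "'a set \<Rightarrow> nat option"

definition colors_of :: "'a coloring \<Rightarrow> 'a set set \<Rightarrow> nat set" where
  "colors_of \<chi> F = {c. \<exists>f\<in>F. \<chi> f = Some c}"

definition proper_edge_coloring :: "nat \<Rightarrow> 'a set set \<Rightarrow> 'a coloring \<Rightarrow> bool" where
  "proper_edge_coloring k E \<chi> \<longleftrightarrow> dom \<chi> = E \<and> ran \<chi> \<subseteq> {1..k} \<and>
     (\<forall>e\<in>E. \<forall>f\<in>E. e \<noteq> f \<longrightarrow> e \<inter> f \<noteq> {} \<longrightarrow> \<chi> e \<noteq> \<chi> f)"


section \<open>The algorithm\<close>

text \<open>The algorithm leaves two choices open (which edge of minimum weight to remove, which
  admissible color to assign), so it is a transition relation. In the first phase the state is the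
  current graph \<open>H = G\<^sub>i\<close> and the stack \<open>[e\<^bsub>i-1\<^esub>, \<dots>, e\<^sub>1]\<close> of removed edges. In the second phase,
  before \<open>e\<^sub>i\<close> is colored, it is \<open>H = G\<^bsub>i+1\<^esub>\<close>, the stack \<open>[e\<^sub>i, \<dots>, e\<^sub>1]\<close> and the current partial
  coloring; hence \<open>G\<^sub>i\<close> is \<open>insert e\<^sub>i H\<close>.\<close>

datatype 'a cg_state =
    PhaseI "'a set set" "'a set list"
  | PhaseII "'a set set" "'a set list" "'a coloring"

inductive cg_step :: "'a cg_state \<Rightarrow> 'a cg_state \<Rightarrow> bool" where
  remove: "\<lbrakk>e \<in> H; \<forall>f\<in>H. \<Phi> H e \<le> \<Phi> H f\<rbrakk>
    \<Longrightarrow> cg_step (PhaseI H es) (PhaseI (H - {e}) (e # es))"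
| switch: "cg_step (PhaseI {} es) (PhaseII {} es Map.empty)"
| color: "c \<in> {1..(\<Sum>v\<in>e. degree (insert e H) v) - 1} - colors_of \<chi> (edge_nbhd H e)
    \<Longrightarrow> cg_step (PhaseII H (e # es) \<chi>) (PhaseII (insert e H) es (\<chi>(e \<mapsto> c)))"

definition cg_reachable :: "'a set set \<Rightarrow> 'a cg_state \<Rightarrow> bool" where
  "cg_reachable E s \<longleftrightarrow> cg_step\<^sup>*\<^sup>* (PhaseI E []) s"

definition cg_returns :: "'a set set \<Rightarrow> 'a coloring \<Rightarrow> bool" where
  "cg_returns E \<chi> \<longleftrightarrow> (\<exists>H. cg_reachable E (PhaseII H [] \<chi>))"

text \<open>However the choices are made, the run is finite and ends by returning a coloring: it never
  reaches a point where no admissible edge or color exists.\<close>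

definition cg_always_returns :: "'a set set \<Rightarrow> bool" where
  "cg_always_returns E \<longleftrightarrow>
     (\<nexists>\<sigma>. \<sigma> 0 = PhaseI E [] \<and> (\<forall>i::nat. cg_step (\<sigma> i) (\<sigma> (Suc i)))) \<and>
     (\<forall>s. cg_reachable E s \<longrightarrow> (\<exists>H \<chi>. s = PhaseII H [] \<chi>) \<or> (\<exists>s'. cg_step s s'))"


section \<open>The machine model\<close>

text \<open>Running time is measured on a word RAM with \<open>w\<close>-bit words, programmed by structured commands
  over registers and an indirectly addressed memory. Every operation, memory access and test takes
  unit time; all results are reduced modulo \<open>2^w\<close>, so only addresses below \<open>2^w\<close> are accessible.
  Subtraction is cut off at 0, and division by 0 yields 0.\<close>

record store =
  regs :: "nat \<Rightarrow> nat"
  mem :: "nat \<Rightarrow> nat"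

datatype aexp = Const nat | Reg nat | Load aexp
  | Add aexp aexp | Sub aexp aexp | Mul aexp aexp | Div aexp aexp

datatype bexp = Less aexp aexp | Eq aexp aexp | Neg bexp | Conj bexp bexp

datatype com = Skip | Assign nat aexp | Store aexp aexp | Seq com com
  | Ite bexp com com | While bexp com

fun aval :: "nat \<Rightarrow> aexp \<Rightarrow> store \<Rightarrow> nat" where
  "aval w (Const c) s = c mod 2 ^ w"
| "aval w (Reg r) s = regs s r"
| "aval w (Load a) s = mem s (aval w a s)"
| "aval w (Add a b) s = (aval w a s + aval w b s) mod 2 ^ w"
| "aval w (Sub a b) s = aval w a s - aval w b s"
| "aval w (Mul a b) s = (aval w a s * aval w b s) mod 2 ^ w"
| "aval w (Div a b) s = aval w a s div aval w b s"

fun bval :: "nat \<Rightarrow> bexp \<Rightarrow> store \<Rightarrow> bool" where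
  "bval w (Less a b) s \<longleftrightarrow> aval w a s < aval w b s"
| "bval w (Eq a b) s \<longleftrightarrow> aval w a s = aval w b s"
| "bval w (Neg b) s \<longleftrightarrow> \<not> bval w b s"
| "bval w (Conj b c) s \<longleftrightarrow> bval w b s \<and> bval w c s"

fun acost :: "aexp \<Rightarrow> nat" where
  "acost (Const c) = 1"
| "acost (Reg r) = 1"
| "acost (Load a) = 1 + acost a"
| "acost (Add a b) = 1 + acost a + acost b"
| "acost (Sub a b) = 1 + acost a + acost b"
| "acost (Mul a b) = 1 + acost a + acost b"
| "acost (Div a b) = 1 + acost a + acost b"

fun bcost :: "bexp \<Rightarrow> nat" where
  "bcost (Less a b) = 1 + acost a + acost b"
| "bcost (Eq a b) = 1 + acost a + acost b"
| "bcost (Neg b) = 1 + bcost b"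
| "bcost (Conj b c) = 1 + bcost b + bcost c"

text \<open>\<open>exec w c s t s'\<close>: with word length \<open>w\<close>, command \<open>c\<close> started in \<open>s\<close> halts in \<open>s'\<close> after
  time \<open>t\<close>.\<close>

inductive exec :: "nat \<Rightarrow> com \<Rightarrow> store \<Rightarrow> nat \<Rightarrow> store \<Rightarrow> bool" for w :: nat where
  Skip: "exec w Skip s 1 s"
| Assign: "exec w (Assign r a) s (1 + acost a) (s\<lparr>regs := (regs s)(r := aval w a s)\<rparr>)"
| Store: "exec w (Store a b) s (1 + acost a + acost b)
    (s\<lparr>mem := (mem s)(aval w a s := aval w b s)\<rparr>)"
| Seq: "\<lbrakk>exec w c s t s'; exec w d s' u s''\<rbrakk> \<Longrightarrow> exec w (Seq c d) s (t + u) s''"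
| IteTrue: "\<lbrakk>bval w b s; exec w c s t s'\<rbrakk> \<Longrightarrow> exec w (Ite b c d) s (1 + bcost b + t) s'"
| IteFalse: "\<lbrakk>\<not> bval w b s; exec w d s t s'\<rbrakk> \<Longrightarrow> exec w (Ite b c d) s (1 + bcost b + t) s'"
| WhileFalse: "\<not> bval w b s \<Longrightarrow> exec w (While b c) s (1 + bcost b) s"
| WhileTrue: "\<lbrakk>bval w b s; exec w c s t s'; exec w (While b c) s' u s''\<rbrakk>
    \<Longrightarrow> exec w (While b c) s (1 + bcost b + t + u) s''"

text \<open>The input is a graph on the vertices \<open>0, \<dots>, n - 1\<close> given by a list of its edges, in any order
  and with arbitrarily ordered endpoints.\<close>

definition edge_of :: "nat \<times> nat \<Rightarrow> nat set" where
  "edge_of p = {fst p, snd p}"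

definition edges_of :: "(nat \<times> nat) list \<Rightarrow> nat set set" where
  "edges_of ps = edge_of ` set ps"

definition edge_list :: "nat \<Rightarrow> (nat \<times> nat) list \<Rightarrow> bool" where
  "edge_list n ps \<longleftrightarrow> simple_graph {0..<n} (edges_of ps) \<and> distinct (map edge_of ps)"

text \<open>Initially register 0 contains \<open>n\<close>, register 1 contains \<open>m\<close>, memory cells \<open>2 * i\<close> and
  \<open>2 * i + 1\<close> contain the endpoints of the \<open>i\<close>-th edge for \<open>i < m\<close>, and all else is 0. On
  termination cell \<open>2 * m + i\<close> contains the color of the \<open>i\<close>-th edge.\<close>

definition input_store :: "nat \<Rightarrow> (nat \<times> nat) list \<Rightarrow> store" where
  "input_store n ps = \<lparr>regs = (\<lambda>_. 0)(0 := n, 1 := length ps),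
     mem = (\<lambda>a. if a < 2 * length ps
                then (if even a then fst (ps ! (a div 2)) else snd (ps ! (a div 2))) else 0)\<rparr>"

definition output_coloring :: "(nat \<times> nat) list \<Rightarrow> store \<Rightarrow> nat coloring" where
  "output_coloring ps s =
     map_of (zip (map edge_of ps) (map (\<lambda>i. mem s (2 * length ps + i)) [0..<length ps]))"

end

theory Submission
  imports Defs
begin

text \<open>In every subgraph some edge has weight at most \<open>2\<alpha> - 1\<close>, since the average degree of its
  non-isolated vertices is below \<open>2\<alpha>\<close>. Hence every palette of the second phase is contained in
  \<open>{1, \<dots>, \<Delta> + 2\<alpha> - 1}\<close>, and it has more colors than the edge has colored neighbours.

  For the running time, an edge of minimum weight is any edge at a non-isolated vertex of minimum
  degree, and removing an edge lowers the minimum degree by at most one, so the first phase takes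
  linear time with a lazy bucket queue of the vertices. In the second phase every vertex keeps a
  binary heap that counts its used colors in dyadic intervals. Descending the heaps of both endpoints
  simultaneously, always to the left child if it holds fewer used colors than leaves, finds an
  admissible color in time \<open>O(log \<Delta>)\<close>, and the counters are updated on the way.\<close>

text \<open>The time bound does not involve the number of vertices, so there is no initialization
  per vertex: vertices enter only through half-edges, and all arrays start from zero memory.

  The obstacle of the second phase is that the palette depends on the edge, whereas all heaps have
  the same number of leaves, the least power of two that is at least 2\<Delta>. A color that is free
  at both endpoints may therefore lie outside the palette. The rule for turning right resolves this:
  it skips only leaves that are outnumbered or matched by used colors, so the color reached exceeds
  the number of colored neighbours by at most one. Since the argument only compares numbers, a color
  used at both endpoints may be counted twice, and the two counters are simply added.

  The invariants of the program contain reachability under \<open>cg_step\<close>. The machine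
  result is thus a result of the algorithm itself, and freedom and range of a color are checked
  once, as the side condition of a coloring step. The time obtained is linear in log \<Delta>, which
  is stronger than the bound required.\<close>

section \<open>Degrees, arboricity and light edges\<close>

lemma finite_edges: "simple_graph V E \<Longrightarrow> finite E"
  unfolding simple_graph_def by (meson Pow_iff finite_Pow_iff rev_finite_subset subsetI)

lemma edge_weight_pair: "\<Phi> H {u, v} = min (degree H u) (degree H v)"
  by (simp add: edge_weight_def)

lemma degree_insert:
  assumes "finite H" "e \<notin> H"
  shows "degree (insert e H) v = degree H v + (if v \<in> e then 1 else 0)"
proof -
  have "{f \<in> insert e H. v \<in> f} = (if v \<in> e then insert e {f \<in> H. v \<in> f} else {f \<in> H. v \<in> f})"
    by auto
  then show ?thesis using assms by (simp add: degree_def)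
qed

lemma degree_Diff:
  assumes "finite H" "e \<in> H"
  shows "degree H v = degree (H - {e}) v + (if v \<in> e then 1 else 0)"
  using degree_insert[of "H - {e}" e v] assms by (simp add: insert_absorb)

lemma degree_mono: "finite E \<Longrightarrow> H \<subseteq> E \<Longrightarrow> degree H v \<le> degree E v"
  unfolding degree_def by (rule card_mono) auto

lemma degree_le_max_degree: "finite V \<Longrightarrow> v \<in> V \<Longrightarrow> degree E v \<le> max_degree V E"
  unfolding max_degree_def by (rule Max_ge) auto

text \<open>Double counting of incidences: every edge lies inside \<open>S\<close> and has two
  elements there.\<close>

lemma sum_degree:
  assumes "finite H" "finite S" "\<And>e. e \<in> H \<Longrightarrow> e \<subseteq> S \<and> card e = 2"
  shows "(\<Sum>v\<in>S. degree H v) = 2 * card H"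
proof -
  have "(\<Sum>v\<in>S. degree H v) = (\<Sum>v\<in>S. \<Sum>e\<in>H. if v \<in> e then 1 else 0)"
    using assms(1) by (simp add: degree_def sum.If_cases Int_def)
  also have "\<dots> = (\<Sum>e\<in>H. \<Sum>v\<in>S. if v \<in> e then 1 else 0)"
    by (rule sum.swap)
  also have "\<dots> = (\<Sum>e\<in>H. 2)"
  proof (rule sum.cong)
    fix e assume "e \<in> H"
    then have "S \<inter> e = e" "card e = 2" using assms(3) by auto
    then show "(\<Sum>v\<in>S. if v \<in> e then 1 else 0) = (2::nat)"
      using assms(2) by (simp add: sum.If_cases)
  qed simp
  finally show ?thesis by simp
qed

text \<open>This clears rounding and division from the definition of arboricity, once the
  \<open>LEAST\<close> is known to be attained.\<close>

lemma card_induced_edges_le: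
  assumes "simple_graph V E" "S \<subseteq> V" "card S \<ge> 2"
  shows "card (induced_edges E S) \<le> arboricity V E * (card S - 1)"
proof -
  let ?Q = "\<lambda>a. \<forall>S \<subseteq> V. card S \<ge> 2 \<longrightarrow>
     \<lceil>real (card (induced_edges E S)) / (real (card S) - 1)\<rceil> \<le> int a"
  \<comment> \<open>The \<open>LEAST\<close> ranges over a nonempty set: for \<open>card S\<close>
    \<ge> 2 the denominator is at least 1, so \<open>card E\<close> bounds every quotient.\<close>
  have "?Q (card E)"
  proof (intro allI impI)
    fix S :: "'a set" assume S: "card S \<ge> 2"
    have "card (induced_edges E S) \<le> card E"
      using finite_edges[OF assms(1)] by (auto intro: card_mono simp: induced_edges_def)
    moreover have "real (card (induced_edges E S)) / (real (card S) - 1)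
        \<le> real (card (induced_edges E S))"
      using S mult_right_mono[of 1 "real (card S) - 1" "real (card (induced_edges E S))"]
      by (simp add: divide_le_eq mult.commute)
    ultimately show "\<lceil>real (card (induced_edges E S)) / (real (card S) - 1)\<rceil> \<le> int (card E)"
      by (simp add: ceiling_le_iff)
  qed
  then have "?Q (arboricity V E)"
    unfolding arboricity_def by (rule LeastI)
  then have "real (card (induced_edges E S)) / (real (card S) - 1) \<le> real (arboricity V E)"
    using assms(2,3) by (auto simp: ceiling_le_iff)
  then have "real (card (induced_edges E S)) \<le> real (arboricity V E) * (real (card S) - 1)"
    using assms(3) by (simp add: divide_le_eq)
  also have "\<dots> = real (arboricity V E * (card S - 1))"
    using assms(3) by (simp add: of_nat_diff)
  finally show ?thesis by (simp only: of_nat_le_iff)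
qed

lemma exists_light_edge:
  assumes G: "simple_graph V E" and H: "H \<subseteq> E" "H \<noteq> {}"
  shows "\<exists>e\<in>H. \<Phi> H e < 2 * arboricity V E"
proof -
  let ?S = "\<Union>H"
  have SV: "?S \<subseteq> V" and fV: "finite V" and two: "\<And>e. e \<in> H \<Longrightarrow> card e = 2"
    using G H by (auto simp: simple_graph_def)
  have fS: "finite ?S" using SV fV by (rule finite_subset)
  have fH: "finite H" using H(1) finite_edges[OF G] by (rule finite_subset)
  obtain e where "e \<in> H" using H by auto
  then have "card e \<le> card ?S" using fS by (intro card_mono) auto
  then have S2: "card ?S \<ge> 2" using two[OF \<open>e \<in> H\<close>] by simp
  have "card H \<le> card (induced_edges E ?S)"
    using H(1) finite_edges[OF G] by (intro card_mono) (auto simp: induced_edges_def)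
  then have le: "card H \<le> arboricity V E * (card ?S - 1)"
    using card_induced_edges_le[OF G SV S2] by linarith
  have "\<exists>v\<in>?S. degree H v < 2 * arboricity V E"
  proof (rule ccontr)
    assume "\<not> ?thesis"
    then have "(\<Sum>v\<in>?S. 2 * arboricity V E) \<le> (\<Sum>v\<in>?S. degree H v)"
      by (intro sum_mono) (auto simp: not_less)
    also have "\<dots> = 2 * card H"
      using fH fS two by (intro sum_degree) auto
    finally have "card ?S * arboricity V E \<le> card H" by simp
    moreover have "card H > 0" using H(2) fH by (simp add: card_gt_0_iff)
    \<comment> \<open>Writing \<alpha> for the arboricity, \<open>card H\<close> would be at least
      \<alpha> times \<open>card ?S\<close> and at most that number minus \<alpha>. This forces
      \<alpha> = 0 and then \<open>card H = 0\<close>.\<close>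
    moreover have "arboricity V E * (card ?S - 1) + arboricity V E = card ?S * arboricity V E"
      using S2 by (cases "card ?S") auto
    ultimately show False using le by (cases "arboricity V E") auto
  qed
  then obtain v f where "v \<in> f" "f \<in> H" "degree H v < 2 * arboricity V E" by auto
  moreover have "\<Phi> H f \<le> degree H v"
    unfolding edge_weight_def using \<open>v \<in> f\<close> two[OF \<open>f \<in> H\<close>]
    by (intro Min_le finite_imageI) (auto intro: card_ge_0_finite)
  ultimately show ?thesis by (meson le_less_trans)
qed

lemma card_edge_nbhd_le:
  assumes "finite H"
  shows "card (edge_nbhd H {u, v}) \<le> degree H u + degree H v"
proof -
  have "card (edge_nbhd H {u, v}) \<le> card ({f \<in> H. u \<in> f} \<union> {f \<in> H. v \<in> f})"
    using assms by (intro card_mono) (auto simp: edge_nbhd_def)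
  also have "\<dots> \<le> degree H u + degree H v"
    unfolding degree_def by (rule card_Un_le)
  finally show ?thesis .
qed

text \<open>Both endpoints count the edge itself, and only one of these two is subtracted: the
  palette has one color more than the total degree before the insertion.\<close>

lemma sum_degree_insert_edge:
  assumes "finite H" "{u, v} \<notin> H" "u \<noteq> v"
  shows "(\<Sum>x\<in>{u, v}. degree (insert {u, v} H) x) - 1 = Suc (degree H u + degree H v)"
  using assms by (simp add: degree_insert)

section \<open>Runs of the algorithm: invariant, termination and progress\<close>

text \<open>In a reachable state of the second phase, every edge on the stack still has minimum weight in
  the graph consisting of the current graph and the part of the stack above it; this is what
  bounds its palette when it gets colored.\<close>

fun cg_inv :: "nat \<Rightarrow> 'a set set \<Rightarrow> 'a cg_state \<Rightarrow> bool" where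
  "cg_inv k E (PhaseI H es) \<longleftrightarrow> distinct es \<and> set es \<inter> H = {} \<and> set es \<union> H = E \<and>
     (\<forall>xs e ys. es = xs @ e # ys \<longrightarrow>
        (\<forall>f \<in> insert e (H \<union> set xs). \<Phi> (insert e (H \<union> set xs)) e \<le> \<Phi> (insert e (H \<union> set xs)) f))"
| "cg_inv k E (PhaseII H es \<chi>) \<longleftrightarrow> distinct es \<and> set es \<inter> H = {} \<and> set es \<union> H = E \<and>
     (\<forall>xs e ys. es = xs @ e # ys \<longrightarrow>
        (\<forall>f \<in> insert e (H \<union> set xs). \<Phi> (insert e (H \<union> set xs)) e \<le> \<Phi> (insert e (H \<union> set xs)) f)) \<and>
     proper_edge_coloring k H \<chi>"

text \<open>The lighter endpoint has degree at most 2\<alpha> - 1 and the other one at most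
  \<Delta>; the subtraction on the left even leaves one color to spare.\<close>

lemma palette_le:
  assumes G: "simple_graph V E" and He: "insert e H \<subseteq> E"
    and min: "\<forall>f \<in> insert e H. \<Phi> (insert e H) e \<le> \<Phi> (insert e H) f"
  shows "(\<Sum>v\<in>e. degree (insert e H) v) - 1 \<le> max_degree V E + 2 * arboricity V E - 1"
proof -
  have "e \<subseteq> V" "card e = 2" "finite V" using G He by (auto simp: simple_graph_def)
  then obtain u v where e: "e = {u, v}" "u \<noteq> v" by (auto simp: card_2_iff)
  obtain f where "f \<in> insert e H" "\<Phi> (insert e H) f < 2 * arboricity V E"
    using exists_light_edge[OF G He] by auto
  then have "\<Phi> (insert e H) e < 2 * arboricity V E" using min by (meson le_less_trans)
  then have "min (degree (insert e H) u) (degree (insert e H) v) < 2 * arboricity V E"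
    by (simp add: e edge_weight_pair)
  moreover have "degree (insert e H) x \<le> max_degree V E" if "x \<in> e" for x
    using degree_mono[OF finite_edges[OF G] He, of x] \<open>e \<subseteq> V\<close> that
      degree_le_max_degree[OF \<open>finite V\<close>, of x E] by auto
  ultimately show ?thesis using e by (fastforce simp: min_def split: if_splits)
qed

lemma proper_edge_coloring_insert:
  assumes "proper_edge_coloring k H \<chi>" "e \<notin> H" "c \<in> {1..k}"
    and "\<And>f. f \<in> H \<Longrightarrow> f \<inter> e \<noteq> {} \<Longrightarrow> \<chi> f \<noteq> Some c"
  shows "proper_edge_coloring k (insert e H) (\<chi>(e \<mapsto> c))"
  unfolding proper_edge_coloring_def
proof (intro conjI ballI impI)
  have pr: "dom \<chi> = H" "ran \<chi> \<subseteq> {1..k}"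
    "\<And>e f. e \<in> H \<Longrightarrow> f \<in> H \<Longrightarrow> e \<noteq> f \<Longrightarrow> e \<inter> f \<noteq> {} \<Longrightarrow> \<chi> e \<noteq> \<chi> f"
    using assms(1) unfolding proper_edge_coloring_def by blast+
  show "dom (\<chi>(e \<mapsto> c)) = insert e H" using pr by simp
  have "\<chi> e = None" using pr(1) assms(2) by blast
  then show "ran (\<chi>(e \<mapsto> c)) \<subseteq> {1..k}" using pr(2) assms(3) by (simp add: ran_map_upd)
  fix f g assume "f \<in> insert e H" "g \<in> insert e H" "f \<noteq> g" "f \<inter> g \<noteq> {}"
  then show "(\<chi>(e \<mapsto> c)) f \<noteq> (\<chi>(e \<mapsto> c)) g"
    using pr(3)[of f g] assms(4)[of f] assms(4)[of g] by (cases "f = e"; cases "g = e") (auto simp: Int_commute)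
qed

lemma cg_inv_step:
  assumes "cg_step s s'" and G: "simple_graph V E"
    and "cg_inv (max_degree V E + 2 * arboricity V E - 1) E s"
  shows "cg_inv (max_degree V E + 2 * arboricity V E - 1) E s'"
  using assms(1,3)
proof (induction rule: cg_step.induct)
  case (remove e H es)
  \<comment> \<open>An older stack entry sees the same graph as before, because \<open>e\<close>
    only moves from \<open>H\<close> into the prefix above it. The new top entry has the empty
    prefix and sees all of \<open>H\<close>.\<close>
  have eq: "insert e' (H - {e} \<union> set xs) = (case xs of [] \<Rightarrow> H | _ # zs \<Rightarrow> insert e' (H \<union> set zs))"
    if "e # es = xs @ e' # ys" for xs e' ys
    using that remove.hyps by (cases xs) auto
  have "\<forall>f \<in> insert e' (H - {e} \<union> set xs).
      \<Phi> (insert e' (H - {e} \<union> set xs)) e' \<le> \<Phi> (insert e' (H - {e} \<union> set xs)) f"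
    if "e # es = xs @ e' # ys" for xs e' ys
    unfolding eq[OF that] using that remove by (cases xs) auto
  then show ?case using remove by auto
next
  case (switch es)
  then show ?case by (simp add: proper_edge_coloring_def)
next
  case (color c e H \<chi> es)
  let ?k = "max_degree V E + 2 * arboricity V E - 1"
  have pr: "proper_edge_coloring ?k H \<chi>" and eH: "e \<notin> H" "insert e H \<subseteq> E"
    using color.prems by auto
  \<comment> \<open>The empty prefix gives the minimality of \<open>e\<close> in the graph in which
    its palette is computed.\<close>
  have "\<forall>f \<in> insert e H. \<Phi> (insert e H) e \<le> \<Phi> (insert e H) f"
    using color.prems by (auto dest!: spec[of _ "[]"])
  then have "c \<in> {1..?k}" using palette_le[OF G eH(2)] color.hyps by fastforce
  moreover have "\<chi> f \<noteq> Some c" if "f \<in> H" "f \<inter> e \<noteq> {}" for f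
    using color.hyps that eH by (auto simp: colors_of_def edge_nbhd_def)
  ultimately have "proper_edge_coloring ?k (insert e H) (\<chi>(e \<mapsto> c))"
    using pr eH by (intro proper_edge_coloring_insert) auto
  moreover have "\<forall>f \<in> insert e' (insert e H \<union> set xs).
      \<Phi> (insert e' (insert e H \<union> set xs)) e' \<le> \<Phi> (insert e' (insert e H \<union> set xs)) f"
    if "es = xs @ e' # ys" for xs e' ys
  proof -
    have "e # es = (e # xs) @ e' # ys" using that by simp
    then have "\<forall>f \<in> insert e' (H \<union> set (e # xs)).
      \<Phi> (insert e' (H \<union> set (e # xs))) e' \<le> \<Phi> (insert e' (H \<union> set (e # xs))) f"
      using color.prems unfolding cg_inv.simps by blast
    then show ?thesis by simp
  qed
  ultimately show ?case using color.prems by auto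
qed

lemma cg_inv_reachable:
  assumes "simple_graph V E" "cg_reachable E s"
  shows "cg_inv (max_degree V E + 2 * arboricity V E - 1) E s"
  using assms(2) unfolding cg_reachable_def
proof (induction rule: rtranclp_induct)
  case base
  show ?case by simp
next
  case (step s s')
  then show ?case using cg_inv_step[OF _ assms(1)] by blast
qed

text \<open>An edge of \<open>H\<close> has a removal and a coloring ahead, an edge on the stack
  only a coloring; the \<open>Suc\<close> pays for the switch of phases.\<close>

fun cg_measure :: "'a cg_state \<Rightarrow> nat" where
  "cg_measure (PhaseI H es) = Suc (2 * card H + length es)"
| "cg_measure (PhaseII H es \<chi>) = length es"

lemma cg_measure_step:
  assumes "cg_step s s'" "cg_inv k E s" "finite E"
  shows "cg_measure s' < cg_measure s"
  using assms
proof (induction rule: cg_step.induct)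
  case (remove e H es)
  then have "finite H" by auto
  then show ?case using remove card_Suc_Diff1[of H e] by simp
qed auto

lemma cg_step_exists:
  assumes "cg_inv k E s" and G: "simple_graph V E"
  shows "(\<exists>H \<chi>. s = PhaseII H [] \<chi>) \<or> (\<exists>s'. cg_step s s')"
proof (cases s)
  case (PhaseI H es)
  show ?thesis
  proof (cases "H = {}")
    case True
    then show ?thesis using PhaseI cg_step.switch by blast
  next
    case False
    have "finite H" using assms(1) PhaseI finite_edges[OF G] by auto
    then have "\<exists>e\<in>H. \<forall>f\<in>H. \<Phi> H e \<le> \<Phi> H f"
      using ex_min_if_finite[of "\<Phi> H ` H"] False by (fastforce simp: not_less)
    then show ?thesis using PhaseI cg_step.remove by blast
  qed
next
  case (PhaseII H es \<chi>)
  show ?thesis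
  proof (cases es)
    case Nil
    then show ?thesis using PhaseII by simp
  next
    case (Cons e es')
    have eH: "e \<in> E" "e \<notin> H" "finite H"
      using assms(1) PhaseII Cons finite_edges[OF G] by auto
    then have "card e = 2" using G by (simp add: simple_graph_def)
    then obtain u v where e: "e = {u, v}" "u \<noteq> v" by (auto simp: card_2_iff)
    let ?D = "(\<Sum>v\<in>e. degree (insert e H) v) - 1"
    have fin: "finite (edge_nbhd H e)" using eH by (simp add: edge_nbhd_def)
    \<comment> \<open>On an uncolored neighbour \<open>the\<close> has an unspecified value, which
      can only enlarge the right-hand side.\<close>
    have "colors_of \<chi> (edge_nbhd H e) \<subseteq> (\<lambda>f. the (\<chi> f)) ` edge_nbhd H e"
      by (force simp: colors_of_def)
    then have "card (colors_of \<chi> (edge_nbhd H e)) \<le> card (edge_nbhd H e)"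
      using fin by (meson card_image_le card_mono finite_imageI le_trans)
    also have "\<dots> < ?D"
      using card_edge_nbhd_le[OF eH(3), of u v] sum_degree_insert_edge[OF eH(3), of u v] e eH
      by simp
    finally have "card (colors_of \<chi> (edge_nbhd H e)) < card {1..?D}" by simp
    moreover have "finite (colors_of \<chi> (edge_nbhd H e))"
      using fin \<open>_ \<subseteq> _ ` _\<close> by (meson finite_imageI finite_subset)
    ultimately have "{1..?D} - colors_of \<chi> (edge_nbhd H e) \<noteq> {}"
      by (metis card_mono Diff_eq_empty_iff not_le)
    then obtain c where "c \<in> {1..?D} - colors_of \<chi> (edge_nbhd H e)" by (meson ex_in_conv)
    from cg_step.color[OF this] show ?thesis unfolding PhaseII Cons by (intro disjI2 exI)
  qed
qed

lemma cg_always_returns: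
  assumes G: "simple_graph V E"
  shows "cg_always_returns E"
  unfolding cg_always_returns_def
proof (intro conjI allI impI notI)
  assume "\<exists>\<sigma>. \<sigma> 0 = PhaseI E [] \<and> (\<forall>i::nat. cg_step (\<sigma> i) (\<sigma> (Suc i)))"
  then obtain \<sigma> where \<sigma>: "\<sigma> 0 = PhaseI E []" "\<And>i. cg_step (\<sigma> i) (\<sigma> (Suc i))" by auto
  have "cg_reachable E (\<sigma> i)" for i
  proof (induction i)
    case 0
    then show ?case by (simp add: \<sigma> cg_reachable_def)
  next
    case (Suc i)
    then show ?case using \<sigma>(2)[of i] unfolding cg_reachable_def by simp
  qed
  then have "cg_measure (\<sigma> (Suc i)) < cg_measure (\<sigma> i)" for i
    using cg_measure_step[OF \<sigma>(2) cg_inv_reachable[OF G] finite_edges[OF G]] by blast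
  then show False
    using wf_iff_no_infinite_down_chain[of "measure cg_measure"] by auto
next
  fix s assume "cg_reachable E s"
  then show "(\<exists>H \<chi>. s = PhaseII H [] \<chi>) \<or> (\<exists>s'. cg_step s s')"
    using cg_step_exists[OF cg_inv_reachable[OF G] G] by blast
qed

lemma cg_returns_proper:
  assumes "simple_graph V E" "cg_returns E \<chi>"
  shows "proper_edge_coloring (max_degree V E + 2 * arboricity V E - 1) E \<chi>"
proof -
  obtain H where "cg_reachable E (PhaseII H [] \<chi>)"
    using assms(2) by (auto simp: cg_returns_def)
  from cg_inv_reachable[OF assms(1) this] show ?thesis by auto
qed

section \<open>Changing one summand by one\<close>

lemma sum_fun_upd_Suc:
  fixes f :: "'b \<Rightarrow> nat"
  assumes "finite A" "x \<in> A"
  shows "sum (f(x := Suc (f x))) A = Suc (sum f A)"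
  using assms by (simp add: sum.remove[of A x])

lemma sum_fun_upd_pred:
  fixes f :: "'b \<Rightarrow> nat"
  assumes "finite A" "x \<in> A" "f x > 0"
  shows "Suc (sum (f(x := f x - 1)) A) = sum f A"
  using assms by (simp add: sum.remove[of A x])

section \<open>Lazy bucket queue\<close>

text \<open>Whenever the key of a vertex changes, the vertex is pushed onto the bucket of its new key, and
  its old entries become stale. Keys 0 are of no interest.\<close>

definition buckets :: "nat \<Rightarrow> (nat \<Rightarrow> nat) \<Rightarrow> (nat \<Rightarrow> nat) \<Rightarrow> (nat \<Rightarrow> nat \<Rightarrow> nat) \<Rightarrow> bool" where
  "buckets n dg bc bk \<longleftrightarrow> (\<forall>v. 0 < dg v \<longrightarrow> (\<exists>j<bc (dg v). bk (dg v) j = v)) \<and>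
     (\<forall>d j. j < bc d \<longrightarrow> bk d j < n)"

text \<open>Existing entries stay below the unchanged or raised heights, so only \<open>v\<close>
  needs a new entry, and the one just pushed serves.\<close>

lemma buckets_push:
  assumes "buckets n dg bc bk" "v < n"
  shows "buckets n (dg(v := x)) (bc(x := Suc (bc x))) (bk(x := (bk x)(bc x := v)))"
proof -
  have "\<exists>j<(bc(x := Suc (bc x))) ((dg(v := x)) u). (bk(x := (bk x)(bc x := v))) ((dg(v := x)) u) j = u"
    if u: "0 < (dg(v := x)) u" for u
  proof (cases "u = v")
    case True
    then show ?thesis by (auto intro!: exI[of _ "bc x"])
  next
    case False
    then obtain j where "j < bc (dg u)" "bk (dg u) j = u"
      using assms(1) u unfolding buckets_def by (metis fun_upd_other)
    then show ?thesis using False by (auto intro!: exI[of _ j])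
  qed
  moreover have "(bk(x := (bk x)(bc x := v))) d j < n" if "j < (bc(x := Suc (bc x))) d" for d j
    using assms that by (auto simp: buckets_def split: if_splits)
  ultimately show ?thesis unfolding buckets_def by blast
qed

text \<open>A stale top entry is not the entry that represents any vertex under its current key, so
  all representatives lie below the new height.\<close>

lemma buckets_pop:
  assumes "buckets n dg bc bk" "0 < bc d" "dg (bk d (bc d - 1)) \<noteq> d"
  shows "buckets n dg (bc(d := bc d - 1)) bk"
proof -
  have "\<exists>j<(bc(d := bc d - 1)) (dg u). bk (dg u) j = u" if u: "0 < dg u" for u
  proof -
    obtain j where j: "j < bc (dg u)" "bk (dg u) j = u"
      using assms(1) u unfolding buckets_def by blast
    then have "dg u = d \<longrightarrow> j \<noteq> bc d - 1" using assms(3) by auto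
    then show ?thesis using j by (auto intro!: exI[of _ j])
  qed
  then show ?thesis using assms(1) by (auto simp: buckets_def)
qed

section \<open>Ancestors in a binary heap\<close>

text \<open>Heap numbering with root 1, where the parent of \<open>y\<close> is
  \<open>y div 2\<close>. The formula also makes 0 an ancestor of every number, whence the
  assumptions that nodes are positive.\<close>

definition anc :: "nat \<Rightarrow> nat \<Rightarrow> bool" where
  "anc x y \<longleftrightarrow> (\<exists>j. x = y div 2 ^ j)"

lemma anc_refl: "anc x x"
  unfolding anc_def by (rule exI[of _ 0]) simp

lemma anc_le: "anc x y \<Longrightarrow> x \<le> y"
  unfolding anc_def by (auto simp: div_le_dividend)

lemma anc_trans: "anc x y \<Longrightarrow> anc y z \<Longrightarrow> anc x z"
  unfolding anc_def by (metis div_mult2_eq power_add)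

lemma anc_half: "anc (x div 2) x"
  unfolding anc_def by (rule exI[of _ 1]) simp

lemma anc_rec: "anc x y \<longleftrightarrow> x = y \<or> anc x (y div 2)"
proof
  assume "anc x y"
  then obtain j where j: "x = y div 2 ^ j" by (auto simp: anc_def)
  then show "x = y \<or> anc x (y div 2)"
    by (cases j) (auto simp: anc_def div_mult2_eq)
qed (use anc_refl anc_trans[OF _ anc_half] in blast)

lemma anc_linear: "anc x z \<Longrightarrow> anc y z \<Longrightarrow> anc x y \<or> anc y x"
proof -
  have "anc (z div 2 ^ i) (z div 2 ^ j)" if "j \<le> i" for i j
    unfolding anc_def using that
    by (auto intro!: exI[of _ "i - j"] simp flip: div_mult2_eq power_add)
  then show "anc x z \<Longrightarrow> anc y z \<Longrightarrow> anc x y \<or> anc y x"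
    unfolding anc_def[of _ z] by (metis nat_le_linear)
qed

text \<open>Ancestors of a common node are comparable. The larger sibling is no ancestor of the
  smaller one, and conversely the parent of the larger one is \<open>x\<close>, which is below
  \<open>2 * x\<close>. Hence sibling subtrees are disjoint and their counters can be added.\<close>

lemma anc_siblings:
  assumes "1 \<le> x"
  shows "\<not> (anc (2 * x) y \<and> anc (2 * x + 1) y)"
proof
  assume "anc (2 * x) y \<and> anc (2 * x + 1) y"
  then have "anc (2 * x) (2 * x + 1) \<or> anc (2 * x + 1) (2 * x)" using anc_linear by blast
  then have "anc (2 * x) (2 * x + 1)" using anc_le by fastforce
  then have "anc (2 * x) x" using anc_rec[of "2 * x" "2 * x + 1"] by simp
  then show False using anc_le assms by fastforce
qed

section \<open>Invariants of the two phases\<close>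

locale graph_input =
  fixes n :: nat and ps :: "(nat \<times> nat) list"
  assumes edge_list: "edge_list n ps"
begin

definition m :: nat where "m = length ps"
definition ed :: "nat \<Rightarrow> nat set" where "ed e = edge_of (ps ! e)"
abbreviation E :: "nat set set" where "E \<equiv> edges_of ps"

text \<open>The cells of the input: the \<open>h\<close>-th half-edge belongs to the edge \<open>h div 2\<close>.\<close>

definition vt :: "nat \<Rightarrow> nat" where
  "vt h = (if even h then fst (ps ! (h div 2)) else snd (ps ! (h div 2)))"

lemma graph: "simple_graph {0..<n} E"
  using edge_list by (simp add: edge_list_def)

lemma finE: "finite E" using finite_edges[OF graph] .

lemma E_eq: "E = ed ` {..<m}"
  unfolding edges_of_def ed_def m_def set_conv_nth by auto

lemma inj_ed: "inj_on ed {..<m}"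
proof -
  have "distinct (map edge_of ps)" using edge_list by (simp add: edge_list_def)
  then show ?thesis unfolding ed_def m_def inj_on_def by (auto simp: distinct_conv_nth)
qed

lemma ed_vt: "ed e = {vt (2 * e), vt (2 * e + 1)}"
  by (simp add: ed_def edge_of_def vt_def)

lemma ed_props:
  assumes "e < m"
  shows "vt (2 * e) < n" "vt (2 * e + 1) < n" "vt (2 * e) \<noteq> vt (2 * e + 1)"
proof -
  have "ed e \<in> E" using assms E_eq by auto
  then have "ed e \<subseteq> {0..<n}" "card (ed e) = 2" using graph by (auto simp: simple_graph_def)
  then show "vt (2 * e) < n" "vt (2 * e + 1) < n" "vt (2 * e) \<noteq> vt (2 * e + 1)"
    unfolding ed_vt by (auto simp: card_2_iff doubleton_eq_iff)
qed

lemma vt_less: "h < 2 * m \<Longrightarrow> vt h < n"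
  using ed_props(1,2)[of "h div 2"] by (cases "even h") auto

lemma card_ed_image: "S \<subseteq> {..<m} \<Longrightarrow> card (ed ` S) = card S"
  using inj_ed by (meson card_image inj_on_subset)

lemma degree_le_m: "S \<subseteq> {..<m} \<Longrightarrow> degree (ed ` S) v \<le> m"
proof -
  assume S: "S \<subseteq> {..<m}"
  then have "finite S" by (rule finite_subset) simp
  then have "degree (ed ` S) v \<le> card (ed ` S)" unfolding degree_def by (intro card_mono) auto
  also have "\<dots> \<le> m" using card_ed_image[OF S] card_mono[OF _ S] by simp
  finally show ?thesis .
qed

text \<open>As the endpoints of an edge differ, each edge at \<open>v\<close> has exactly one
  half-edge at \<open>v\<close>, so counting half-edges yields degrees.\<close>

lemma degree_E: "degree E v = card {h. h < 2 * m \<and> vt h = v}"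
proof -
  have "bij_betw (\<lambda>h. ed (h div 2)) {h. h < 2 * m \<and> vt h = v} {e \<in> E. v \<in> e}"
  proof (rule bij_betw_imageI)
    show "inj_on (\<lambda>h. ed (h div 2)) {h. h < 2 * m \<and> vt h = v}"
    proof (rule inj_onI, clarify)
      fix g h assume gh: "g < 2 * m" "h < 2 * m" "ed (g div 2) = ed (h div 2)" "vt h = vt g"
      then have eq: "g div 2 = h div 2" using inj_ed by (auto simp: inj_on_def)
      have "vt (2 * (g div 2)) \<noteq> vt (2 * (g div 2) + 1)" using gh by (intro ed_props) auto
      then have "even g \<longleftrightarrow> even h" using gh(4) eq
        by (metis dvd_mult_div_cancel odd_two_times_div_two_succ)
      then show "g = h" using eq by (metis div_mod_decomp even_iff_mod_2_eq_zero odd_iff_mod_2_eq_one)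
    qed
    show "(\<lambda>h. ed (h div 2)) ` {h. h < 2 * m \<and> vt h = v} = {e \<in> E. v \<in> e}"
    proof safe
      fix h assume "h < 2 * m"
      then show "ed (h div 2) \<in> E" using E_eq by auto
      show "vt h \<in> ed (h div 2)" unfolding ed_vt by (cases "even h") auto
    next
      fix f assume "f \<in> E" "v \<in> f"
      then obtain e where e: "e < m" "f = ed e" "v = vt (2 * e) \<or> v = vt (2 * e + 1)"
        using E_eq ed_vt by auto
      then show "f \<in> (\<lambda>h. ed (h div 2)) ` {h. h < 2 * m \<and> vt h = v}"
        by (elim disjE) (force intro: rev_image_eqI[of "2 * e"], force intro: rev_image_eqI[of "2 * e + 1"])
    qed
  qed
  then show ?thesis unfolding degree_def by (simp add: bij_betw_same_card)
qed

section \<open>Initialization: incidence stacks and buckets\<close>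

text \<open>Each half-edge pushes one incidence and one bucket entry. The two sums record this: they
  keep indices small and fix the initial potential of the first phase. Keys up to
  \<open>2 * m\<close> suffice because a degree is at most the number of half-edges read.\<close>

definition init_inv :: "nat \<Rightarrow> (nat \<Rightarrow> nat) \<Rightarrow> (nat \<Rightarrow> nat \<Rightarrow> nat) \<Rightarrow> (nat \<Rightarrow> nat) \<Rightarrow>
    (nat \<Rightarrow> nat) \<Rightarrow> (nat \<Rightarrow> nat \<Rightarrow> nat) \<Rightarrow> nat \<Rightarrow> bool" where
  "init_inv h dg adj ap bc bk \<Delta> \<longleftrightarrow> h \<le> 2 * m \<and> (\<forall>v. dg v = card {g. g < h \<and> vt g = v}) \<and>
     buckets n dg bc bk \<and> (\<forall>g<h. \<exists>j<ap (vt g). adj (vt g) j = g div 2) \<and>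
     (\<forall>v j. j < ap v \<longrightarrow> adj v j < m \<and> v \<in> ed (adj v j)) \<and>
     (\<Sum>v<n. ap v) = h \<and> (\<Sum>d\<le>2*m. bc d) = h \<and>
     (\<forall>v. dg v \<le> \<Delta>) \<and> (\<Delta> = 0 \<or> (\<exists>v<n. dg v = \<Delta>))"

lemma init_inv_start: "init_inv 0 (\<lambda>_. 0) adj (\<lambda>_. 0) (\<lambda>_. 0) bk 0"
  by (simp add: init_inv_def buckets_def)

lemma init_inv_bounds:
  assumes "init_inv h dg adj ap bc bk \<Delta>" "h < 2 * m"
  shows "dg v < 2 * m" "v < n \<Longrightarrow> ap v \<le> 2 * m" "d \<le> 2 * m \<Longrightarrow> bc d \<le> 2 * m"
proof -
  note a = assms[unfolded init_inv_def]
  have "dg v = card {g. g < h \<and> vt g = v}" using a by blast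
  also have "\<dots> \<le> card {..<h}" by (intro card_mono) auto
  finally show "dg v < 2 * m" using assms(2) by simp
  show "ap v \<le> 2 * m" if "v < n" using member_le_sum[of v "{..<n}" ap] a that by simp
  show "bc d \<le> 2 * m" if "d \<le> 2 * m" using member_le_sum[of d "{..2*m}" bc] a that by simp
qed

lemma init_inv_step:
  assumes I: "init_inv h dg adj ap bc bk \<Delta>" and h: "h < 2 * m" and v: "v = vt h"
    and x: "x = Suc (dg v)"
  shows "init_inv (Suc h) (dg(v := x)) (adj(v := (adj v)(ap v := h div 2))) (ap(v := Suc (ap v)))
    (bc(x := Suc (bc x))) (bk(x := (bk x)(bc x := v))) (if \<Delta> < x then x else \<Delta>)"
proof -
  note a = I[unfolded init_inv_def]
  have vn: "v < n" using vt_less[OF h] v by simp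
  have x2: "x \<le> 2 * m" using init_inv_bounds(1)[OF I h, of v] x by simp
  have "(dg(v := x)) u = card {g. g < Suc h \<and> vt g = u}" for u
  proof -
    have "{g. g < Suc h \<and> vt g = u} = (if u = v then insert h {g. g < h \<and> vt g = u}
        else {g. g < h \<and> vt g = u})"
      using v by (auto simp: less_Suc_eq)
    then show ?thesis using a x by auto
  qed
  moreover have "buckets n (dg(v := x)) (bc(x := Suc (bc x))) (bk(x := (bk x)(bc x := v)))"
    using a vn by (intro buckets_push) auto
  moreover have "\<exists>j<(ap(v := Suc (ap v))) (vt g). (adj(v := (adj v)(ap v := h div 2))) (vt g) j = g div 2"
    if "g < Suc h" for g
  proof (cases "g = h")
    case True
    then show ?thesis using v by (auto intro!: exI[of _ "ap v"])
  next
    case False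
    then have "g < h" using that by simp
    then obtain j where "j < ap (vt g)" "adj (vt g) j = g div 2" using a by blast
    then show ?thesis by (auto intro!: exI[of _ j])
  qed
  moreover have "v \<in> ed (h div 2)" unfolding v ed_vt by (cases "even h") auto
  then have "(adj(v := (adj v)(ap v := h div 2))) u j < m \<and>
      u \<in> ed ((adj(v := (adj v)(ap v := h div 2))) u j)" if "j < (ap(v := Suc (ap v))) u" for u j
    using a that h by (auto simp: less_Suc_eq split: if_splits)
  moreover have "sum (ap(v := Suc (ap v))) {..<n} = Suc h"
    using sum_fun_upd_Suc[of "{..<n}" v ap] vn a by (simp del: fun_upd_apply)
  moreover have "sum (bc(x := Suc (bc x))) {..2*m} = Suc h"
    using sum_fun_upd_Suc[of "{..2*m}" x bc] x2 a by (simp del: fun_upd_apply)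
  moreover have "(dg(v := x)) u \<le> (if \<Delta> < x then x else \<Delta>)" for u
  proof -
    have "dg u \<le> \<Delta>" using a by blast
    then show ?thesis by auto
  qed
  moreover have "(if \<Delta> < x then x else \<Delta>) = 0 \<or> (\<exists>u<n. (dg(v := x)) u = (if \<Delta> < x then x else \<Delta>))"
  proof (cases "\<Delta> < x")
    case True
    then show ?thesis using vn by auto
  next
    case False
    then have "x \<le> \<Delta>" "\<Delta> \<noteq> 0" using x by auto
    then obtain u where "u < n" "dg u = \<Delta>" using a by auto
    \<comment> \<open>The degree of \<open>v\<close> was \<open>x - 1\<close>, below \<Delta>, so
      the maximum is attained elsewhere and survives the update.\<close>
    moreover have "u \<noteq> v" using \<open>x \<le> \<Delta>\<close> x calculation by auto
    ultimately show ?thesis using False by auto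
  qed
  ultimately show ?thesis using h unfolding init_inv_def by (intro conjI) (blast | simp)+
qed

section \<open>First phase: removal of edges of minimum weight\<close>

definition alive :: "(nat \<Rightarrow> nat) \<Rightarrow> nat set" where
  "alive rm = {e. e < m \<and> rm e = 0}"

definition stack :: "(nat \<Rightarrow> nat) \<Rightarrow> nat \<Rightarrow> nat set list" where
  "stack st k = map (\<lambda>i. ed (st i)) (rev [0..<k])"

lemma stack_Suc: "stack st (Suc k) = ed (st k) # stack st k"
  by (simp add: stack_def)

lemma stack_cong: "(\<And>i. i < k \<Longrightarrow> st i = st' i) \<Longrightarrow> stack st k = stack st' k"
  by (simp add: stack_def)

text \<open>Injectivity of \<open>st\<close> turns it into a permutation of the edges once
  \<open>k = m\<close>. Only alive edges are required to be present on the incidence stacks; removed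
  ones may linger. The bound \<open>d\<close> \<le> \<open>m + 1\<close> keeps the subtraction in
  the potential below exact.\<close>

definition phase1_inv :: "nat \<Rightarrow> nat \<Rightarrow> (nat \<Rightarrow> nat) \<Rightarrow> (nat \<Rightarrow> nat \<Rightarrow> nat) \<Rightarrow> (nat \<Rightarrow> nat) \<Rightarrow>
    (nat \<Rightarrow> nat) \<Rightarrow> (nat \<Rightarrow> nat \<Rightarrow> nat) \<Rightarrow> (nat \<Rightarrow> nat) \<Rightarrow> (nat \<Rightarrow> nat) \<Rightarrow> bool" where
  "phase1_inv k d dg adj ap bc bk rm st \<longleftrightarrow> k \<le> m \<and> inj_on st {..<k} \<and>
     st ` {..<k} = {..<m} - alive rm \<and>
     cg_reachable E (PhaseI (ed ` alive rm) (stack st k)) \<and>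
     (\<forall>v. dg v = degree (ed ` alive rm) v) \<and> buckets n dg bc bk \<and>
     (\<forall>e\<in>alive rm. \<forall>v\<in>ed e. \<exists>j<ap v. adj v j = e) \<and>
     (\<forall>v j. j < ap v \<longrightarrow> adj v j < m \<and> v \<in> ed (adj v j)) \<and>
     1 \<le> d \<and> d \<le> m + 1 \<and> (\<forall>v. 0 < dg v \<longrightarrow> d \<le> dg v)"

text \<open>A removal pushes two bucket entries and lowers \<open>d\<close> by at most one, which its weight 3 pays
  for, and it pops an incidence; every other iteration lowers one of the first three summands.\<close>

definition pot :: "nat \<Rightarrow> nat \<Rightarrow> (nat \<Rightarrow> nat) \<Rightarrow> (nat \<Rightarrow> nat) \<Rightarrow> nat" where
  "pot k d ap bc = (\<Sum>v<n. ap v) + (\<Sum>d\<le>2*m. bc d) + (m + 1 - d) + 3 * (m - k)"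

lemma alive_sub: "alive rm \<subseteq> {..<m}" by (auto simp: alive_def)

lemma finite_alive: "finite (alive rm)" using alive_sub by (rule finite_subset) simp

lemma phase1_start:
  assumes "init_inv (2 * m) dg adj ap bc bk \<Delta>"
  shows "phase1_inv 0 1 dg adj ap bc bk (\<lambda>_. 0) st" "pot 0 1 ap bc = 8 * m"
    "\<Delta> \<le> max_degree {0..<n} E" "degree E v \<le> \<Delta>"
proof -
  note a = assms[unfolded init_inv_def]
  have al: "alive (\<lambda>_. 0) = {..<m}" by (auto simp: alive_def)
  have dg: "dg v = degree E v" for v using a degree_E by simp
  have "\<exists>j<ap v. adj v j = e" if "e < m" "v \<in> ed e" for e v
  proof -
    have "v = vt (2 * e) \<or> v = vt (2 * e + 1)" using that ed_vt by auto
    then have "\<exists>g. g < 2 * m \<and> g div 2 = e \<and> v = vt g"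
    proof
      assume "v = vt (2 * e)"
      then show ?thesis using that(1) by (intro exI[of _ "2 * e"]) simp
    next
      assume "v = vt (2 * e + 1)"
      then show ?thesis using that(1) by (intro exI[of _ "2 * e + 1"]) simp
    qed
    then obtain g where "g < 2 * m" "g div 2 = e" "v = vt g" by blast
    then show ?thesis using a by blast
  qed
  then show "phase1_inv 0 1 dg adj ap bc bk (\<lambda>_. 0) st"
    using a dg unfolding phase1_inv_def al
    by (simp add: stack_def cg_reachable_def E_eq Suc_le_eq)
  \<comment> \<open>The summands are \<open>2 * m\<close> incidences, \<open>2 * m\<close> bucket
    entries, \<open>m\<close> for the degree bound and \<open>3 * m\<close> for the
    removals.\<close>
  show "pot 0 1 ap bc = 8 * m" using a by (simp add: pot_def)
  show "\<Delta> \<le> max_degree {0..<n} E" using a dg degree_le_max_degree[of "{0..<n}" _ E] by fastforce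
  show "degree E v \<le> \<Delta>" using a dg by metis
qed

text \<open>The potential never grows, so it also bounds all stack heights; this is what keeps
  addresses within a word.\<close>

lemma phase1_bounds:
  assumes "pot k d ap bc \<le> 8 * m"
  shows "v < n \<Longrightarrow> ap v \<le> 8 * m" "d' \<le> 2 * m \<Longrightarrow> bc d' \<le> 8 * m"
  using member_le_sum[of v "{..<n}" ap] member_le_sum[of d' "{..2*m}" bc] assms
  by (auto simp: pot_def)

lemma phase1_dg_le:
  assumes "phase1_inv k d dg adj ap bc bk rm st"
  shows "dg v \<le> m"
  using assms degree_le_m[OF alive_sub] by (simp add: phase1_inv_def)

lemma phase1_alive_nonempty:
  assumes "phase1_inv k d dg adj ap bc bk rm st" "k < m"
  obtains e where "e \<in> alive rm"
proof -
  note a = assms[unfolded phase1_inv_def]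
  have "card (st ` {..<k}) = k" using a by (metis card_image card_lessThan)
  then have "alive rm \<noteq> {}" using a assms(2) by auto
  then show ?thesis using that by blast
qed

text \<open>A vertex of degree \<open>d\<close> would have an entry in bucket \<open>d\<close>, so
  an empty bucket excludes that degree. An alive edge then supplies a vertex of larger degree, which
  shows \<open>Suc d\<close> \<le> \<open>m\<close>, so that the summand \<open>m + 1 - d\<close>
  really drops.\<close>

lemma phase1_advance:
  assumes I: "phase1_inv k d dg adj ap bc bk rm st" and k: "k < m" and b: "bc d = 0"
  shows "phase1_inv k (Suc d) dg adj ap bc bk rm st" "Suc (pot k (Suc d) ap bc) \<le> pot k d ap bc"
proof -
  note a = I[unfolded phase1_inv_def]
  have lt: "Suc d \<le> dg v" if "0 < dg v" for v
  proof -
    have "\<exists>j<bc (dg v). bk (dg v) j = v" using a that by (auto simp: buckets_def)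
    then have "dg v \<noteq> d" using b by auto
    moreover have "d \<le> dg v" using a that by blast
    ultimately show ?thesis by simp
  qed
  obtain e where e: "e \<in> alive rm" using phase1_alive_nonempty[OF I k] .
  have "{f \<in> ed ` alive rm. vt (2 * e) \<in> f} \<noteq> {}" using e ed_vt by auto
  then have "0 < degree (ed ` alive rm) (vt (2 * e))"
    unfolding degree_def using finite_alive by (simp add: card_gt_0_iff)
  then have "Suc d \<le> dg (vt (2 * e))" using lt a by simp
  then have "Suc d \<le> m" using phase1_dg_le[OF I, of "vt (2 * e)"] by linarith
  then show "phase1_inv k (Suc d) dg adj ap bc bk rm st" "Suc (pot k (Suc d) ap bc) \<le> pot k d ap bc"
    using a lt unfolding phase1_inv_def pot_def by auto
qed

lemma phase1_stale:
  assumes I: "phase1_inv k d dg adj ap bc bk rm st" and k: "k < m" and b: "0 < bc d"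
    and st: "dg (bk d (bc d - 1)) \<noteq> d"
  shows "phase1_inv k d dg adj ap (bc(d := bc d - 1)) bk rm st"
    "Suc (pot k d ap (bc(d := bc d - 1))) \<le> pot k d ap bc"
proof -
  note a = I[unfolded phase1_inv_def]
  show "phase1_inv k d dg adj ap (bc(d := bc d - 1)) bk rm st"
    using a buckets_pop[of n dg bc bk d] b st unfolding phase1_inv_def by blast
  have "d \<le> 2 * m" using a k by auto
  then show "Suc (pot k d ap (bc(d := bc d - 1))) \<le> pot k d ap bc"
    unfolding pot_def using sum_fun_upd_pred[of "{..2*m}" d bc] b by (simp del: fun_upd_apply)
qed

text \<open>A vertex of degree \<open>d\<close> \<ge> 1 has an alive edge, and the entry of that
  edge shows that the incidence stack is not empty.\<close>

lemma phase1_current: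
  assumes I: "phase1_inv k d dg adj ap bc bk rm st" and b: "0 < bc d"
    and v: "v = bk d (bc d - 1)" "dg v = d" and e: "e = adj v (ap v - 1)"
  shows "v < n" "0 < ap v" "e < m" "v \<in> ed e"
proof -
  note a = I[unfolded phase1_inv_def]
  show "v < n" using a b v unfolding buckets_def by auto
  have "0 < degree (ed ` alive rm) v" using a v by auto
  then have "{f \<in> ed ` alive rm. v \<in> f} \<noteq> {}" unfolding degree_def by (auto simp: card_gt_0_iff)
  then obtain f where "f \<in> alive rm" "v \<in> ed f" by auto
  then show ap: "0 < ap v" using a by fastforce
  then show "e < m" "v \<in> ed e" using a e by auto
qed

text \<open>An edge is stored at both endpoints but popped only where it is found, so its other
  entry outlives it. Discarding that entry later harms no alive edge.\<close>

lemma phase1_dead: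
  assumes I: "phase1_inv k d dg adj ap bc bk rm st" and b: "0 < bc d"
    and v: "v = bk d (bc d - 1)" "dg v = d" and e: "e = adj v (ap v - 1)" and rm: "rm e \<noteq> 0"
  shows "phase1_inv k d dg adj (ap(v := ap v - 1)) bc bk rm st"
    "Suc (pot k d (ap(v := ap v - 1)) bc) \<le> pot k d ap bc"
proof -
  note a = I[unfolded phase1_inv_def]
  note c = phase1_current[OF I b v e]
  have "\<exists>j<(ap(v := ap v - 1)) u. adj u j = f" if f: "f \<in> alive rm" "u \<in> ed f" for f u
  proof -
    obtain j where j: "j < ap u" "adj u j = f" using a f by blast
    have "f \<noteq> e" using f rm by (auto simp: alive_def)
    then have "u = v \<longrightarrow> j \<noteq> ap v - 1" using j e by auto
    then show ?thesis using j by (auto intro!: exI[of _ j])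
  qed
  moreover have "adj u j < m \<and> u \<in> ed (adj u j)" if "j < (ap(v := ap v - 1)) u" for u j
    using a that by (auto split: if_splits)
  ultimately show "phase1_inv k d dg adj (ap(v := ap v - 1)) bc bk rm st"
    using a unfolding phase1_inv_def by blast
  show "Suc (pot k d (ap(v := ap v - 1)) bc) \<le> pot k d ap bc"
    unfolding pot_def using sum_fun_upd_pred[of "{..<n}" v ap] c by (simp del: fun_upd_apply)
qed

text \<open>The second push starts from \<open>bc1\<close> and \<open>bk1\<close> because the
  endpoints may get the same new degree and share a bucket. A vertex whose degree becomes 0 is
  pushed as well, onto a bucket that is never inspected.\<close>

lemma phase1_remove:
  assumes I: "phase1_inv k d dg adj ap bc bk rm st" and k: "k < m" and b: "0 < bc d"
    and v: "v = bk d (bc d - 1)" "dg v = d" and e: "e = adj v (ap v - 1)" and rm: "rm e = 0"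
    and p: "p = vt (2 * e)" and q: "q = vt (2 * e + 1)"
    and x: "x = dg p - 1" and y: "y = dg q - 1"
    and bc1: "bc1 = bc(x := Suc (bc x))" and bk1: "bk1 = bk(x := (bk x)(bc x := p))"
    and bc2: "bc2 = bc1(y := Suc (bc1 y))" and bk2: "bk2 = bk1(y := (bk1 y)(bc1 y := q))"
  shows "phase1_inv (Suc k) (1 + (d - 2)) (dg(p := x, q := y)) adj (ap(v := ap v - 1)) bc2 bk2
      (rm(e := 1)) (st(k := e))"
    "Suc (pot (Suc k) (1 + (d - 2)) (ap(v := ap v - 1)) bc2) \<le> pot k d ap bc"
proof -
  note a = I[unfolded phase1_inv_def]
  note c = phase1_current[OF I b v e]
  let ?R = "alive rm" and ?R' = "alive (rm(e := 1))"
  have R': "?R' = ?R - {e}" by (auto simp: alive_def)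
  have eR: "e \<in> ?R" using c rm by (simp add: alive_def)
  have edR': "ed ` ?R' = ed ` ?R - {ed e}"
    unfolding R' using inj_ed alive_sub[of rm] eR by (auto simp: inj_on_def)
  have pq: "p < n" "q < n" "p \<noteq> q" using ed_props[OF c(3)] p q by auto
  have ede: "ed e = {p, q}" using ed_vt p q by simp
  have "finite (ed ` ?R)" using finite_alive by simp
  then have deg: "degree (ed ` ?R) u = degree (ed ` ?R') u + (if u \<in> ed e then 1 else 0)" for u
    unfolding edR' using eR by (intro degree_Diff) auto
  have dg': "(dg(p := x, q := y)) u = degree (ed ` ?R') u" for u
    using deg[of u] a x y ede by auto
  have dge: "d \<le> degree (ed ` ?R) u" if "f \<in> ?R" "u \<in> ed f" for f u
  proof -
    have "{f \<in> ed ` ?R. u \<in> f} \<noteq> {}" using that by auto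
    then have "0 < degree (ed ` ?R) u"
      unfolding degree_def using finite_alive by (simp add: card_gt_0_iff)
    then show ?thesis using a by metis
  qed
  have "\<Phi> (ed ` ?R) (ed e) \<le> d"
    unfolding edge_weight_def using c(4) a v ede by (intro Min_le) auto
  moreover have "d \<le> \<Phi> (ed ` ?R) (ed f)" if "f \<in> ?R" for f
    unfolding edge_weight_def using dge[OF that] ed_vt[of f] by auto
  ultimately have "cg_step (PhaseI (ed ` ?R) (stack st k)) (PhaseI (ed ` ?R') (ed e # stack st k))"
    unfolding edR' using eR by (intro cg_step.remove) (auto intro: le_trans)
  moreover have "stack (st(k := e)) (Suc k) = ed e # stack st k"
    using stack_cong[of k "st(k := e)" st] by (simp add: stack_Suc)
  ultimately have reach: "cg_reachable E (PhaseI (ed ` ?R') (stack (st(k := e)) (Suc k)))"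
    using a unfolding cg_reachable_def by (metis rtranclp.rtrancl_into_rtrancl)
  have "e \<notin> st ` {..<k}" using a eR by auto
  then have f1: "inj_on (st(k := e)) {..<Suc k}" using a by (auto simp: inj_on_def less_Suc_eq)
  have f2: "(st(k := e)) ` {..<Suc k} = {..<m} - ?R'"
    using a c(3) unfolding R' lessThan_Suc by (auto simp: image_iff)
  have f3: "buckets n (dg(p := x, q := y)) bc2 bk2"
    unfolding bc2 bk2 using a pq bc1 bk1 by (intro buckets_push) (auto intro: buckets_push)
  have f4: "\<exists>j<(ap(v := ap v - 1)) u. adj u j = f" if f: "f \<in> ?R'" "u \<in> ed f" for f u
  proof -
    obtain j where j: "j < ap u" "adj u j = f" using a f R' by blast
    have "f \<noteq> e" using f R' by auto
    then have "u = v \<longrightarrow> j \<noteq> ap v - 1" using j e by auto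
    then show ?thesis using j by (auto intro!: exI[of _ j])
  qed
  have f5: "adj u j < m \<and> u \<in> ed (adj u j)" if "j < (ap(v := ap v - 1)) u" for u j
    using a that by (auto split: if_splits)
  \<comment> \<open>Since subtraction is cut off at 0, \<open>1 + (d - 2)\<close> is the maximum of
    1 and \<open>d - 1\<close>.\<close>
  have f6: "1 + (d - 2) \<le> m + 1" "1 \<le> 1 + (d - 2)" using a by auto
  have f7: "1 + (d - 2) \<le> (dg(p := x, q := y)) u" if "0 < (dg(p := x, q := y)) u" for u
  proof -
    have "0 < dg u" using that x y by (auto split: if_splits)
    then have "d \<le> dg u" using a by blast
    then show ?thesis using that x y by (auto split: if_splits)
  qed
  show "phase1_inv (Suc k) (1 + (d - 2)) (dg(p := x, q := y)) adj (ap(v := ap v - 1)) bc2 bk2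
      (rm(e := 1)) (st(k := e))"
    unfolding phase1_inv_def
    by (intro conjI allI ballI impI)
      (rule reach dg' Suc_leI[OF k] f1 f2 f3 f6 | (rule f4 f5[THEN conjunct1] f5[THEN conjunct2] f7, assumption+))+
  have "x \<le> 2 * m" "y \<le> 2 * m" using phase1_dg_le[OF I, of p] phase1_dg_le[OF I, of q] x y by auto
  then have "(\<Sum>d\<le>2*m. bc2 d) = (\<Sum>d\<le>2*m. bc d) + 2"
    using sum_fun_upd_Suc[of "{..2*m}" x bc] sum_fun_upd_Suc[of "{..2*m}" y bc1] bc1 bc2
    by (simp del: fun_upd_apply)
  moreover have "1 \<le> d" "d \<le> m + 1" using a by auto
  ultimately show "Suc (pot (Suc k) (1 + (d - 2)) (ap(v := ap v - 1)) bc2) \<le> pot k d ap bc"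
    unfolding pot_def using sum_fun_upd_pred[of "{..<n}" v ap] c k by (simp del: fun_upd_apply)
qed

section \<open>Second phase: color counters and the search for a color\<close>

text \<open>\<open>L\<close> is the number of leaves of the heap, and color \<open>c\<close> sits at the leaf \<open>L + c - 1\<close>.\<close>

definition cnt :: "nat \<Rightarrow> (nat \<Rightarrow> nat) \<Rightarrow> nat set \<Rightarrow> nat \<Rightarrow> nat \<Rightarrow> nat" where
  "cnt L out K v x = card {e \<in> K. v \<in> ed e \<and> anc x (L + out e - 1)}"

lemma cnt_le_degree:
  assumes "K \<subseteq> {..<m}"
  shows "cnt L out K v x \<le> degree (ed ` K) v"
proof -
  have fK: "finite K" using assms by (rule finite_subset) simp
  have "cnt L out K v x \<le> card {e \<in> K. v \<in> ed e}"
    unfolding cnt_def using fK by (intro card_mono) auto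
  also have "\<dots> = card (ed ` {e \<in> K. v \<in> ed e})"
    using assms by (subst card_ed_image) auto
  also have "ed ` {e \<in> K. v \<in> ed e} = {f \<in> ed ` K. v \<in> f}" by auto
  finally show ?thesis by (simp add: degree_def)
qed

text \<open>The subtrees of the children are disjoint and lie in that of \<open>x\<close>. Equality
  may fail, since a color sitting at \<open>x\<close> itself is counted at neither child.\<close>

lemma cnt_children:
  assumes "K \<subseteq> {..<m}" "1 \<le> x"
  shows "cnt L out K v (2 * x) + cnt L out K v (2 * x + 1) \<le> cnt L out K v x"
proof -
  let ?A = "\<lambda>x. {e \<in> K. v \<in> ed e \<and> anc x (L + out e - 1)}"
  have fK: "finite K" using assms(1) by (rule finite_subset) simp
  have "card (?A (2 * x)) + card (?A (2 * x + 1)) = card (?A (2 * x) \<union> ?A (2 * x + 1))"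
    using fK anc_siblings[OF assms(2)] by (intro card_Un_disjoint[symmetric]) auto
  also have "\<dots> \<le> card (?A x)"
  proof (intro card_mono)
    have "anc x (2 * x)" "anc x (2 * x + 1)"
      using anc_half[of "2 * x"] anc_half[of "2 * x + 1"] by auto
    then show "?A (2 * x) \<union> ?A (2 * x + 1) \<subseteq> ?A x" using anc_trans by blast
  qed (use fK in simp)
  finally show ?thesis by (simp add: cnt_def)
qed

lemma cnt_insert:
  assumes "finite K" "e \<notin> K"
  shows "cnt L (out(e := c)) (insert e K) v x =
    cnt L out K v x + (if v \<in> ed e \<and> anc x (L + c - 1) then 1 else 0)"
proof -
  have "{f \<in> insert e K. v \<in> ed f \<and> anc x (L + (out(e := c)) f - 1)} =
     (if v \<in> ed e \<and> anc x (L + c - 1) then insert e {f \<in> K. v \<in> ed f \<and> anc x (L + out f - 1)}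
      else {f \<in> K. v \<in> ed f \<and> anc x (L + out f - 1)})"
    using assms(2) by auto
  then show ?thesis using assms by (auto simp: cnt_def)
qed

text \<open>The search for a color of \<open>e = {u, v}\<close> has reached node \<open>x\<close> at depth \<open>i\<close>, whose subtree has
  \<open>p\<close> leaves. The subtree contains fewer than \<open>p\<close> colored edges at \<open>u\<close> and \<open>v\<close>, hence a free
  color. The leaves to its left number \<open>x * p - L\<close>, and at least as many edges at \<open>u\<close> and \<open>v\<close> have
  their colors there, hence the color found lies within the palette. The counters on the path to
  \<open>x\<close> already account for the new color.\<close>

definition search_inv :: "nat \<Rightarrow> (nat \<Rightarrow> nat) \<Rightarrow> nat set \<Rightarrow> nat \<Rightarrow> nat \<Rightarrow> nat \<Rightarrow> nat \<Rightarrow>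
    (nat \<Rightarrow> nat \<Rightarrow> nat) \<Rightarrow> bool" where
  "search_inv h out K e i x p T \<longleftrightarrow> i \<le> h \<and> 2 ^ i \<le> x \<and> x < 2 ^ (i + 1) \<and> p = 2 ^ (h - i) \<and>
     (\<Sum>v\<in>ed e. cnt (2 ^ h) out K v x) < p \<and>
     x * p + (\<Sum>v\<in>ed e. cnt (2 ^ h) out K v x) \<le> 2 ^ h + (\<Sum>v\<in>ed e. degree (ed ` K) v) \<and>
     (\<forall>v y. 2 \<le> y \<longrightarrow> T v y = cnt (2 ^ h) out K v y + (if v \<in> ed e \<and> anc y x then 1 else 0))"

text \<open>The stack is consumed from the top, so the colored edges are \<open>st\<close> at the
  indices from \<open>k\<close> on. The root is exempt from the condition on counters because the
  search starts there and only touches children.\<close>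

definition phase2_inv :: "nat \<Rightarrow> (nat \<Rightarrow> nat) \<Rightarrow> nat \<Rightarrow> (nat \<Rightarrow> nat \<Rightarrow> nat) \<Rightarrow> (nat \<Rightarrow> nat) \<Rightarrow> bool" where
  "phase2_inv h st k T out \<longleftrightarrow> k \<le> m \<and> inj_on st {..<m} \<and> st ` {..<m} = {..<m} \<and>
     (\<exists>\<chi>. cg_reachable E (PhaseII (ed ` st ` {k..<m}) (stack st k) \<chi>) \<and>
        (\<forall>e\<in>st ` {k..<m}. \<chi> (ed e) = Some (out e))) \<and>
     (\<forall>v y. 2 \<le> y \<longrightarrow> T v y = cnt (2 ^ h) out (st ` {k..<m}) v y)"

lemma phase2_start:
  assumes "phase1_inv m d dg adj ap bc bk rm st"
  shows "phase2_inv h st m (\<lambda>_ _. 0) out"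
proof -
  note a = assms[unfolded phase1_inv_def]
  \<comment> \<open>An injective list of \<open>m\<close> edges exhausts them, so no edge is alive
    and the switch of phases applies.\<close>
  have "card (st ` {..<m}) = m" using a by (metis card_image card_lessThan)
  moreover have "st ` {..<m} \<subseteq> {..<m}" using a by auto
  ultimately have img: "st ` {..<m} = {..<m}" by (intro card_subset_eq) auto
  have "st ` {..<m} = {..<m} - alive rm" using a by simp
  then have "alive rm = {}" using img alive_sub[of rm] by blast
  then have "cg_reachable E (PhaseI {} (stack st m))" using a by simp
  then have "cg_reachable E (PhaseII {} (stack st m) Map.empty)"
    unfolding cg_reachable_def by (rule rtranclp.rtrancl_into_rtrancl) (rule cg_step.switch)
  then have "\<exists>\<chi>. cg_reachable E (PhaseII (ed ` st ` {m..<m}) (stack st m) \<chi>) \<and>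
        (\<forall>e\<in>st ` {m..<m}. \<chi> (ed e) = Some (out e))" by auto
  then show ?thesis using a img unfolding phase2_inv_def by (simp add: cnt_def)
qed

lemma search_start:
  assumes P: "phase2_inv h st k T out" and k: "0 < k" and e: "e = st (k - 1)"
    and D: "\<And>v. degree E v \<le> D" "2 * D \<le> 2 ^ h"
  shows "search_inv h out (st ` {k..<m}) e 0 1 (2 ^ h) T" "e < m"
proof -
  note a = P[unfolded phase2_inv_def]
  let ?K = "st ` {k..<m}"
  show em: "e < m" using a k e by auto
  have K: "?K \<subseteq> {..<m}" using a by (metis image_mono ivl_subset lessThan_atLeast0 le0 le_refl)
  have "e \<notin> ?K"
  proof
    assume "e \<in> ?K"
    then obtain i where "i \<in> {k..<m}" "st (k - 1) = st i" using e by auto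
    then have "k - 1 = i" using a k by (auto simp: inj_on_def)
    then show False using \<open>i \<in> _\<close> k by auto
  qed
  then have eK: "ed e \<notin> ed ` ?K" using K em by (subst inj_on_image_mem_iff[OF inj_ed]) auto
  have fin: "finite (ed ` ?K)" by simp
  have "insert (ed e) (ed ` ?K) \<subseteq> E" using E_eq K em by auto
  \<comment> \<open>As \<open>e\<close> is still uncolored, each endpoint has fewer than
    \<open>D\<close> colored edges. Together these are fewer than \<open>2 * D\<close>, hence fewer
    than the leaves below the root.\<close>
  then have deg: "degree (ed ` ?K) v < D" if "v \<in> ed e" for v
    using degree_mono[OF finE, of "insert (ed e) (ed ` ?K)" v] degree_insert[OF fin eK, of v] that
      D(1)[of v] by simp
  have e2: "ed e = {vt (2 * e), vt (2 * e + 1)}" "vt (2 * e) \<noteq> vt (2 * e + 1)"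
    using ed_vt ed_props[OF em] by auto
  have "(\<Sum>v\<in>ed e. cnt (2 ^ h) out ?K v 1) \<le> (\<Sum>v\<in>ed e. degree (ed ` ?K) v)"
    by (intro sum_mono cnt_le_degree K)
  moreover have "(\<Sum>v\<in>ed e. degree (ed ` ?K) v) < 2 * D"
    using deg[of "vt (2 * e)"] deg[of "vt (2 * e + 1)"] e2 by simp
  moreover have "\<not> anc y 1" if "2 \<le> y" for y using that anc_le[of y 1] by auto
  ultimately show "search_inv h out ?K e 0 1 (2 ^ h) T"
    using a D(2) unfolding search_inv_def by auto
qed

text \<open>Nodes from the children of \<open>x\<close> on are not on the path walked so far, so
  their counters are still genuine counts and cannot overflow.\<close>

lemma search_bounds:
  assumes S: "search_inv h out K e i x p T" and x: "x < 2 ^ h" and e: "e < m" and K: "K \<subseteq> {..<m}"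
    and y: "2 * x \<le> y"
  shows "T v y \<le> m"
proof -
  have "2 ^ i \<le> x" using S by (simp add: search_inv_def)
  then have "1 \<le> x" by (metis one_le_numeral one_le_power order_trans)
  then have y2: "2 \<le> y" "\<not> anc y x" using anc_le[of y x] y by auto
  then have "T v y = cnt (2 ^ h) out K v y" using S by (simp add: search_inv_def)
  then show ?thesis using cnt_le_degree[OF K] degree_le_m[OF K] by (metis order_trans)
qed

lemma search_step:
  assumes S: "search_inv h out K e i x p T" and x: "x < 2 ^ h" and e: "e < m" and K: "K \<subseteq> {..<m}"
    and u: "u = vt (2 * e)" and v: "v = vt (2 * e + 1)"
    and p': "p' = p div 2"
    and x': "x' = (if T u (2 * x) + T v (2 * x) < p' then 2 * x else 2 * x + 1)"
    and T': "T' = T(u := (T u)(x' := Suc (T u x')), v := (T v)(x' := Suc (T v x')))"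
  shows "search_inv h out K e (Suc i) x' p' T'" "i < h"
proof -
  note a = S[unfolded search_inv_def]
  let ?c = "\<lambda>y. cnt (2 ^ h) out K u y + cnt (2 ^ h) out K v y"
  have uv: "ed e = {u, v}" "u \<noteq> v" using ed_vt ed_props[OF e] u v by auto
  then have sum: "(\<Sum>v\<in>ed e. cnt (2 ^ h) out K v y) = ?c y" for y by simp
  have "(2::nat) ^ i < 2 ^ h" using a x by linarith
  then show ih: "i < h" by simp
  have x1: "1 \<le> x" using a by (metis one_le_numeral one_le_power order_trans)
  have pp: "p = 2 * p'" "p' = 2 ^ (h - Suc i)"
    using a ih p' by (auto simp: Suc_diff_Suc[symmetric])
  \<comment> \<open>A child exceeds \<open>x\<close>, so it is not an ancestor of \<open>x\<close>
    and its counter has not been incremented yet.\<close>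
  have T: "T w (2 * x) = cnt (2 ^ h) out K w (2 * x)" for w
    using a x1 anc_le[of "2 * x" x] by auto
  have child: "?c (2 * x) + ?c (2 * x + 1) \<le> ?c x"
    using cnt_children[OF K x1, of "2 ^ h" out u] cnt_children[OF K x1, of "2 ^ h" out v] by simp
  have lt: "?c x < p" and le: "x * p + ?c x \<le> 2 ^ h + (\<Sum>v\<in>ed e. degree (ed ` K) v)"
    using a sum by auto
  \<comment> \<open>On a left turn \<open>x * p\<close> is unchanged and the count does not grow. On
    a right turn the left child holds at least \<open>p'\<close> used colors: fewer than
    \<open>p'\<close> remain on the right, and the increase of \<open>x * p\<close> by
    \<open>p'\<close> is covered by those left behind.\<close>
  have "?c x' < p'" "x' * p' + ?c x' \<le> 2 ^ h + (\<Sum>v\<in>ed e. degree (ed ` K) v)"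
    using child lt le pp(1) unfolding x' T by (auto simp: algebra_simps)
  moreover have xx: "2 * x \<le> x'" "x' \<le> 2 * x + 1" "x' div 2 = x" using x' by auto
  moreover have "2 ^ Suc i \<le> x'" "x' < 2 ^ (Suc i + 1)" using xx a by auto
  moreover have "T' w y = cnt (2 ^ h) out K w y + (if w \<in> ed e \<and> anc y x' then 1 else 0)"
    if y: "2 \<le> y" for w y
  proof -
    \<comment> \<open>The new path is the old one extended by \<open>x'\<close>, so incrementing
      this single node at both endpoints restores the invariant.\<close>
    have "anc y x' \<longleftrightarrow> y = x' \<or> anc y x" using anc_rec[of y x'] xx(3) by simp
    moreover have "\<not> anc x' x" using anc_le[of x' x] xx x1 by auto
    moreover have "T w y = cnt (2 ^ h) out K w y + (if w \<in> ed e \<and> anc y x then 1 else 0)"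
      using a y by blast
    ultimately show ?thesis using uv T' by auto
  qed
  ultimately show "search_inv h out K e (Suc i) x' p' T'"
    using ih pp sum unfolding search_inv_def by auto
qed

lemma search_end:
  assumes P: "phase2_inv h st k T0 out" and k: "0 < k" and e: "e = st (k - 1)"
    and S: "search_inv h out (st ` {k..<m}) e i x p T" and x: "2 ^ h \<le> x"
  shows "phase2_inv h st (k - 1) T (out(e := x + 1 - 2 ^ h))"
proof -
  note a = P[unfolded phase2_inv_def] and b = S[unfolded search_inv_def]
  let ?K = "st ` {k..<m}" and ?c = "x + 1 - 2 ^ h"
  have em: "e < m" using a k e by auto
  have K: "?K \<subseteq> {..<m}" using a by (metis image_mono ivl_subset lessThan_atLeast0 le0 le_refl)
  have eK: "e \<notin> ?K"
  proof
    assume "e \<in> ?K"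
    then obtain i where "i \<in> {k..<m}" "st (k - 1) = st i" using e by auto
    then have "k - 1 = i" using a k by (auto simp: inj_on_def)
    then show False using \<open>i \<in> _\<close> k by auto
  qed
  then have edK: "ed e \<notin> ed ` ?K" using K em by (subst inj_on_image_mem_iff[OF inj_ed]) auto
  have K': "st ` {k - 1..<m} = insert e ?K"
  proof -
    have "{k - 1..<m} = insert (k - 1) {k..<m}" using a k by auto
    then show ?thesis using e by simp
  qed
  have "i = h"
  proof (rule ccontr)
    assume "i \<noteq> h"
    then have "i + 1 \<le> h" using b by simp
    then have "(2::nat) ^ (i + 1) \<le> 2 ^ h" by (intro power_increasing) auto
    then show False using b x by linarith
  qed
  then have p: "p = 1" using b by simp
  from a have "\<exists>\<chi>. cg_reachable E (PhaseII (ed ` ?K) (stack st k) \<chi>) \<and>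
        (\<forall>e\<in>?K. \<chi> (ed e) = Some (out e))" by (elim conjE)
  then obtain \<chi> where \<chi>: "cg_reachable E (PhaseII (ed ` ?K) (stack st k) \<chi>)"
    "\<And>e. e \<in> ?K \<Longrightarrow> \<chi> (ed e) = Some (out e)" by blast
  have leaf: "2 ^ h + ?c - 1 = x" using x by simp
  have unused: "out f \<noteq> ?c" if f: "f \<in> ?K" "ed f \<inter> ed e \<noteq> {}" for f
  proof
    assume "out f = ?c"
    obtain v where v: "v \<in> ed f" "v \<in> ed e" using f(2) by blast
    \<comment> \<open>At a leaf the subtree has size \<open>p = 1\<close>, so fewer than
      \<open>p\<close> used colors means none.\<close>
    have "(\<Sum>v\<in>ed e. cnt (2 ^ h) out ?K v x) = 0" using b p by simp
    then have "cnt (2 ^ h) out ?K v x = 0" using v ed_vt[of e] by auto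
    then have "{f \<in> ?K. v \<in> ed f \<and> anc x (2 ^ h + out f - 1)} = {}"
      unfolding cnt_def by simp
    moreover have "anc x (2 ^ h + out f - 1)" using \<open>out f = ?c\<close> leaf anc_refl[of x] by simp
    ultimately show False using f(1) v(1) by blast
  qed
  have uv: "ed e = {vt (2 * e), vt (2 * e + 1)}" "vt (2 * e) \<noteq> vt (2 * e + 1)"
    using ed_vt ed_props[OF em] by auto
  \<comment> \<open>The leaf lies at most the total degree to the right of the first leaf
    \<open>2 ^ h\<close>. Colors start at 1, so the color is one more than this offset, exactly what
    the palette allows.\<close>
  have "x \<le> 2 ^ h + (\<Sum>v\<in>ed e. degree (ed ` ?K) v)" using b p by simp
  then have "?c \<le> Suc (\<Sum>v\<in>ed e. degree (ed ` ?K) v)" by linarith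
  also have "\<dots> = (\<Sum>v\<in>ed e. degree (insert (ed e) (ed ` ?K)) v) - 1"
    using sum_degree_insert_edge[of "ed ` ?K" "vt (2 * e)" "vt (2 * e + 1)"] uv edK by simp
  finally have "?c \<in> {1..(\<Sum>v\<in>ed e. degree (insert (ed e) (ed ` ?K)) v) - 1}" using x by simp
  moreover have "?c \<notin> colors_of \<chi> (edge_nbhd (ed ` ?K) (ed e))"
    using unused \<chi>(2) by (fastforce simp: colors_of_def edge_nbhd_def)
  ultimately have "cg_step (PhaseII (ed ` ?K) (ed e # stack st (k - 1)) \<chi>)
      (PhaseII (insert (ed e) (ed ` ?K)) (stack st (k - 1)) (\<chi>(ed e \<mapsto> ?c)))"
    by (intro cg_step.color) blast
  moreover have "stack st k = ed e # stack st (k - 1)" using stack_Suc[of st "k - 1"] k e by simp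
  ultimately have "cg_reachable E (PhaseII (ed ` insert e ?K) (stack st (k - 1)) (\<chi>(ed e \<mapsto> ?c)))"
    using \<chi>(1) unfolding cg_reachable_def image_insert by (metis rtranclp.rtrancl_into_rtrancl)
  moreover have "(\<chi>(ed e \<mapsto> ?c)) (ed f) = Some ((out(e := ?c)) f)" if "f \<in> insert e ?K" for f
    using that \<chi>(2)[of f] edK by (cases "f = e") (auto simp: image_iff)
  moreover have "T v y = cnt (2 ^ h) (out(e := ?c)) (insert e ?K) v y" if "2 \<le> y" for v y
    using b that leaf by (subst cnt_insert[OF _ eK]) auto
  ultimately have "\<exists>\<chi>. cg_reachable E (PhaseII (ed ` insert e ?K) (stack st (k - 1)) \<chi>) \<and>
        (\<forall>f\<in>insert e ?K. \<chi> (ed f) = Some ((out(e := ?c)) f))"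
    "\<forall>v y. 2 \<le> y \<longrightarrow> T v y = cnt (2 ^ h) (out(e := ?c)) (insert e ?K) v y"
    by blast+
  moreover have "k - 1 \<le> m" using a by linarith
  ultimately show ?thesis unfolding phase2_inv_def K' using a by (intro conjI) (elim conjE, assumption)+
qed

text \<open>Output and abstract coloring agree on the edges and are both undefined elsewhere, hence
  are equal as partial functions.\<close>

lemma phase2_end:
  assumes "phase2_inv h st 0 T out" and s: "\<And>e. e < m \<Longrightarrow> mem s (2 * m + e) = out e"
  shows "cg_returns E (output_coloring ps s)"
proof -
  note a = assms(1)[unfolded phase2_inv_def]
  have K: "st ` {0..<m} = {..<m}" using a by (simp add: lessThan_atLeast0)
  have "\<exists>\<chi>. cg_reachable E (PhaseII E [] \<chi>) \<and> (\<forall>e<m. \<chi> (ed e) = Some (out e))"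
    using a unfolding K E_eq[symmetric] by (auto simp: stack_def)
  then obtain \<chi> where \<chi>: "cg_reachable E (PhaseII E [] \<chi>)" "\<And>e. e < m \<Longrightarrow> \<chi> (ed e) = Some (out e)"
    by blast
  have dom: "dom \<chi> = E"
    using cg_inv_reachable[OF graph \<chi>(1)] by (simp add: proper_edge_coloring_def)
  let ?keys = "map edge_of ps" and ?vals = "map (\<lambda>i. mem s (2 * length ps + i)) [0..<length ps]"
  have dist: "distinct ?keys" using edge_list by (simp add: edge_list_def)
  have "output_coloring ps s f = \<chi> f" for f
  proof (cases "f \<in> E")
    case True
    then obtain e where e: "e < m" "f = ed e" using E_eq by auto
    have "map_of (zip ?keys ?vals) (?keys ! e) = Some (?vals ! e)"
      using dist e by (intro map_of_zip_nth) (auto simp: m_def)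
    then have "output_coloring ps s f = Some (mem s (2 * m + e))"
      using e by (simp add: output_coloring_def m_def ed_def)
    then show ?thesis using \<chi>(2)[OF e(1)] e s by simp
  next
    case False
    then have "map_of (zip ?keys ?vals) f = None"
      by (subst map_of_zip_is_None) (auto simp: edges_of_def)
    then show ?thesis using False dom unfolding output_coloring_def by (metis domIff)
  qed
  then have "output_coloring ps s = \<chi>" by (rule ext)
  then show ?thesis using \<chi>(1) unfolding cg_returns_def by blast
qed

end

section \<open>Execution of commands\<close>

lemma exec_deterministic: "exec w c s t s' \<Longrightarrow> exec w c s t' s'' \<Longrightarrow> t' = t \<and> s'' = s'"
proof (induction arbitrary: t' s'' rule: exec.induct)
  case (Skip s)
  then show ?case by (auto elim: exec.cases)
next
  case (Assign r a s)
  then show ?case by (auto elim: exec.cases)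
next
  case (Store a b s)
  then show ?case by (auto elim: exec.cases)
next
  case (Seq c s t s1 d u s2)
  from Seq.prems show ?case by (cases rule: exec.cases) (use Seq.IH in blast)+
next
  case (IteTrue b s c t s1 d)
  from IteTrue.prems show ?case
    by (cases rule: exec.cases) (use IteTrue.IH IteTrue.hyps in blast)+
next
  case (IteFalse b s d t s1 c)
  from IteFalse.prems show ?case
    by (cases rule: exec.cases) (use IteFalse.IH IteFalse.hyps in blast)+
next
  case (WhileFalse b s c)
  from WhileFalse.prems show ?case
    by (cases rule: exec.cases) (use WhileFalse.hyps in auto)
next
  case (WhileTrue b s c t s1 u s2)
  from WhileTrue.prems show ?case
  proof (cases rule: exec.cases)
    case (WhileTrue t1 s3 u1)
    then show ?thesis using WhileTrue.IH by blast
  qed (use WhileTrue.hyps in auto)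
qed

text \<open>Amortized analysis: \<open>q\<close> is a time budget from which every iteration pays
  for its test and body. As each iteration costs at least 1, the loop terminates.\<close>

lemma exec_While:
  assumes step: "\<And>q s. I q s \<Longrightarrow> bval w b s \<Longrightarrow>
      \<exists>t s' q'. exec w c s t s' \<and> I q' s' \<and> 1 + bcost b + t + q' \<le> q"
    and I: "I q s"
  shows "\<exists>t s' q'. exec w (While b c) s t s' \<and> t \<le> q + 1 + bcost b \<and> I q' s' \<and> \<not> bval w b s'"
  using I
proof (induction q arbitrary: s rule: less_induct)
  case (less q)
  show ?case
  proof (cases "bval w b s")
    case False
    then show ?thesis using exec.WhileFalse[OF False, of c] less.prems by force
  next
    case True
    obtain t s1 q1 where 1: "exec w c s t s1" "I q1 s1" "1 + bcost b + t + q1 \<le> q"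
      using step[OF less.prems True] by blast
    then have "q1 < q" by simp
    from less.IH[OF this 1(2)] obtain u s2 q2 where
      2: "exec w (While b c) s1 u s2" "u \<le> q1 + 1 + bcost b" "I q2 s2" "\<not> bval w b s2" by blast
    have "exec w (While b c) s (1 + bcost b + t + u) s2" using exec.WhileTrue[OF True 1(1) 2(1)] .
    moreover have "1 + bcost b + t + u \<le> q + 1 + bcost b" using 1(3) 2(2) by simp
    ultimately show ?thesis using 2(3,4) by blast
  qed
qed

section \<open>Loop-free commands\<close>

definition set_reg :: "nat \<Rightarrow> nat \<Rightarrow> store \<Rightarrow> store" where
  "set_reg r x s = s\<lparr>regs := (regs s)(r := x)\<rparr>"

definition set_mem :: "nat \<Rightarrow> nat \<Rightarrow> store \<Rightarrow> store" where
  "set_mem a x s = s\<lparr>mem := (mem s)(a := x)\<rparr>"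

lemma set_reg_sel [simp]: "regs (set_reg r x s) = (regs s)(r := x)" "mem (set_reg r x s) = mem s"
  by (simp_all add: set_reg_def)

lemma regs_set_mem [simp]: "regs (set_mem a x s) = regs s"
  by (simp add: set_mem_def)

lemma mem_set_mem: "mem (set_mem a x s) b = (if b = a then x else mem s b)"
  by (simp add: set_mem_def)

text \<open>\<open>final\<close> and \<open>max_time\<close> are meaningful for commands without loops only.\<close>

fun loop_free :: "com \<Rightarrow> bool" where
  "loop_free (Seq c d) \<longleftrightarrow> loop_free c \<and> loop_free d"
| "loop_free (Ite b c d) \<longleftrightarrow> loop_free c \<and> loop_free d"
| "loop_free (While b c) \<longleftrightarrow> False"
| "loop_free _ \<longleftrightarrow> True"

fun final :: "nat \<Rightarrow> com \<Rightarrow> store \<Rightarrow> store" where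
  "final w Skip s = s"
| "final w (Assign r a) s = set_reg r (aval w a s) s"
| "final w (Store a b) s = set_mem (aval w a s) (aval w b s) s"
| "final w (Seq c d) s = final w d (final w c s)"
| "final w (Ite b c d) s = (if bval w b s then final w c s else final w d s)"
| "final w (While b c) s = s"

fun max_time :: "com \<Rightarrow> nat" where
  "max_time Skip = 1"
| "max_time (Assign r a) = 1 + acost a"
| "max_time (Store a b) = 1 + acost a + acost b"
| "max_time (Seq c d) = max_time c + max_time d"
| "max_time (Ite b c d) = 1 + bcost b + max (max_time c) (max_time d)"
| "max_time (While b c) = 0"

text \<open>The final store is exact, but the time is only bounded, since the branches of a
  conditional may differ in cost.\<close>

lemma exec_final: "loop_free c \<Longrightarrow> \<exists>t \<le> max_time c. exec w c s t (final w c s)"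
proof (induction c arbitrary: s)
  case Skip
  then show ?case using exec.Skip by force
next
  case (Assign r a)
  then show ?case using exec.Assign[of w r a s] by (auto simp: set_reg_def)
next
  case (Store a b)
  then show ?case using exec.Store[of w a b s] by (auto simp: set_mem_def)
next
  case (Seq c d)
  obtain t where t: "t \<le> max_time c" "exec w c s t (final w c s)" using Seq by auto
  obtain u where u: "u \<le> max_time d" "exec w d (final w c s) u (final w d (final w c s))"
    using Seq by fastforce
  have "exec w (Seq c d) s (t + u) (final w (Seq c d) s)" using exec.Seq[OF t(2) u(2)] by simp
  then show ?case using t(1) u(1) by (intro exI[of _ "t + u"]) simp
next
  case (Ite b c d)
  obtain t where t: "t \<le> max_time c" "exec w c s t (final w c s)" using Ite by auto
  obtain u where u: "u \<le> max_time d" "exec w d s u (final w d s)" using Ite by auto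
  show ?case
  proof (cases "bval w b s")
    case True
    have "exec w (Ite b c d) s (1 + bcost b + t) (final w c s)" using exec.IteTrue[OF True t(2)] .
    then show ?thesis using True t(1) by (intro exI[of _ "1 + bcost b + t"]) simp
  next
    case False
    have "exec w (Ite b c d) s (1 + bcost b + u) (final w d s)" using exec.IteFalse[OF False u(2)] .
    then show ?thesis using False u(1) by (intro exI[of _ "1 + bcost b + u"]) simp
  qed
qed auto

section \<open>Memory layout\<close>

text \<open>Eight two-dimensional arrays are kept above the input and output cells. The quadratic pairing
  function makes their unbounded index ranges disjoint, and since the memory is zero initially, no
  time is needed to initialize them.\<close>

definition cell :: "nat \<Rightarrow> nat \<Rightarrow> nat \<Rightarrow> nat \<Rightarrow> nat" where
  "cell m k i j = 3 * m + (9 * ((i + j) * (i + j) + i) + k)"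

text \<open>Pairs with sum \<open>s\<close> occupy numbers from \<open>s * s\<close> to
  \<open>s * s + s\<close>, all below the next square.\<close>

lemma pair_less:
  fixes i j i' j' :: nat
  assumes "i + j < i' + j'"
  shows "(i + j) * (i + j) + i < (i' + j') * (i' + j') + i'"
proof -
  have "(i + j) * (i + j) + i < Suc (i + j) * Suc (i + j)" by simp
  also have "\<dots> \<le> (i' + j') * (i' + j')" using assms by (intro mult_le_mono) auto
  finally show ?thesis by simp
qed

text \<open>The residue modulo 9 recovers the array, the pairing number its sum of indices, and the
  remainder the first index.\<close>

lemma cell_inject:
  assumes "k < 9" "k' < 9"
  shows "cell m k i j = cell m k' i' j' \<longleftrightarrow> k = k' \<and> i = i' \<and> j = j'"
proof
  assume "cell m k i j = cell m k' i' j'"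
  then have eq: "9 * ((i + j) * (i + j) + i) + k = 9 * ((i' + j') * (i' + j') + i') + k'"
    by (simp add: cell_def)
  then have k: "k = k'" using assms by presburger
  then have p: "(i + j) * (i + j) + i = (i' + j') * (i' + j') + i'" using eq by simp
  then have "i + j = i' + j'"
    using pair_less[of i j i' j'] pair_less[of i' j' i j] by (metis less_irrefl linorder_neqE_nat)
  then show "k = k' \<and> i = i' \<and> j = j'" using p k by simp
qed simp

lemma cell_neq: "a < 3 * m \<Longrightarrow> cell m k i j \<noteq> a"
  by (simp add: cell_def)

definition arr :: "nat \<Rightarrow> store \<Rightarrow> nat \<Rightarrow> nat \<Rightarrow> nat \<Rightarrow> nat" where
  "arr m s k i j = mem s (cell m k i j)"

definition vec :: "nat \<Rightarrow> store \<Rightarrow> nat \<Rightarrow> nat \<Rightarrow> nat" where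
  "vec m s k i = arr m s k i 0"

lemma arr_set_reg [simp]: "arr m (set_reg r x s) = arr m s" "vec m (set_reg r x s) = vec m s"
  by (simp_all add: arr_def vec_def fun_eq_iff)

lemma arr_set_cell [simp]:
  assumes "k < 9" "k' < 9"
  shows "arr m (set_mem (cell m k i j) x s) k' =
      (if k = k' then (arr m s k)(i := (arr m s k i)(j := x)) else arr m s k')"
    and "vec m (set_mem (cell m k i j) x s) k' =
      (if k = k' \<and> j = 0 then (vec m s k)(i := x) else vec m s k')"
  using assms by (auto simp: fun_eq_iff arr_def vec_def cell_inject mem_set_mem)

lemma arr_set_low [simp]:
  assumes "a < 3 * m"
  shows "arr m (set_mem a x s) = arr m s" "vec m (set_mem a x s) = vec m s"
  using cell_neq[OF assms] by (auto simp: fun_eq_iff arr_def vec_def mem_set_mem)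

definition Cell :: "nat \<Rightarrow> aexp \<Rightarrow> aexp \<Rightarrow> aexp" where
  "Cell k a b = Add (Reg 2) (Add (Mul (Const 9) (Add (Mul (Add a b) (Add a b)) a)) (Const k))"

abbreviation Get :: "nat \<Rightarrow> aexp \<Rightarrow> aexp \<Rightarrow> aexp" where "Get k a b \<equiv> Load (Cell k a b)"
abbreviation Put :: "nat \<Rightarrow> aexp \<Rightarrow> aexp \<Rightarrow> aexp \<Rightarrow> com" where "Put k a b x \<equiv> Store (Cell k a b) x"
abbreviation Vec :: "nat \<Rightarrow> aexp \<Rightarrow> aexp" where "Vec k a \<equiv> Get k a (Const 0)"
abbreviation PutVec :: "nat \<Rightarrow> aexp \<Rightarrow> aexp \<Rightarrow> com" where "PutVec k a x \<equiv> Put k a (Const 0) x"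
abbreviation Incr :: "aexp \<Rightarrow> aexp" where "Incr a \<equiv> Add a (Const 1)"
abbreviation Decr :: "aexp \<Rightarrow> aexp" where "Decr a \<equiv> Sub a (Const 1)"

fun Block :: "com list \<Rightarrow> com" where
  "Block [] = Skip"
| "Block [c] = c"
| "Block (c # d # cs) = Seq c (Block (d # cs))"

section \<open>The program\<close>

text \<open>Arrays: 0 degree of a vertex in the current graph; 8 and 2 stack of edges incident to a vertex
  and its height; 3 and 4 heights of the buckets and their entries; 5 marks of the removed edges;
  6 stack of removed edges; 7 heaps of color counters of the vertices.

  Registers: 1 number \<open>m\<close> of edges; 2 start \<open>3 * m\<close> of the arrays; 3 half-edge; 4 maximum degree;
  5 vertex; 6 number of removed edges; 7 lower bound of the minimum degree; 8 edge; 9 degree or node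
  of the heap; 10 number of leaves of the heap; 11 size of a subtree; 12 second vertex.\<close>

definition "push_com = Block [
  PutVec 0 (Reg 5) (Reg 9),
  Put 4 (Reg 9) (Vec 3 (Reg 9)) (Reg 5),
  PutVec 3 (Reg 9) (Incr (Vec 3 (Reg 9)))]"

definition "init_body = Block [
  Assign 5 (Load (Reg 3)),
  Put 8 (Reg 5) (Vec 2 (Reg 5)) (Div (Reg 3) (Const 2)),
  PutVec 2 (Reg 5) (Incr (Vec 2 (Reg 5))),
  Assign 9 (Incr (Vec 0 (Reg 5))),
  push_com,
  Ite (Less (Reg 4) (Reg 9)) (Assign 4 (Reg 9)) Skip,
  Assign 3 (Incr (Reg 3))]"

definition "init_test = Less (Reg 3) (Mul (Const 2) (Reg 1))"

definition "decr_com = Seq (Assign 9 (Decr (Vec 0 (Reg 5)))) push_com"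

definition "remove_com = Block [
  PutVec 5 (Reg 8) (Const 1),
  PutVec 6 (Reg 6) (Reg 8),
  Assign 6 (Incr (Reg 6)),
  Assign 5 (Load (Mul (Const 2) (Reg 8))),
  decr_com,
  Assign 5 (Load (Incr (Mul (Const 2) (Reg 8)))),
  decr_com,
  Assign 7 (Add (Const 1) (Sub (Reg 7) (Const 2)))]"

definition "phase1_body =
  Ite (Eq (Vec 3 (Reg 7)) (Const 0)) (Assign 7 (Incr (Reg 7)))
   (Seq (Assign 5 (Get 4 (Reg 7) (Decr (Vec 3 (Reg 7)))))
     (Ite (Eq (Vec 0 (Reg 5)) (Reg 7))
       (Block [
         PutVec 2 (Reg 5) (Decr (Vec 2 (Reg 5))),
         Assign 8 (Get 8 (Reg 5) (Vec 2 (Reg 5))),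
         Ite (Eq (Vec 5 (Reg 8)) (Const 0)) remove_com Skip])
       (PutVec 3 (Reg 7) (Decr (Vec 3 (Reg 7))))))"

definition "phase1_test = Less (Reg 6) (Reg 1)"

text \<open>Doubling stops at the least power of two that is at least twice the maximum degree,
  enough to accommodate the colors used at two endpoints.\<close>

definition "leaves_body = Assign 10 (Mul (Const 2) (Reg 10))"

definition "leaves_test = Less (Reg 10) (Mul (Const 2) (Reg 4))"

definition "search_body = Block [
  Assign 9 (Mul (Const 2) (Reg 9)),
  Assign 11 (Div (Reg 11) (Const 2)),
  Ite (Less (Add (Get 7 (Reg 5) (Reg 9)) (Get 7 (Reg 12) (Reg 9))) (Reg 11)) Skip
    (Assign 9 (Incr (Reg 9))),
  Put 7 (Reg 5) (Reg 9) (Incr (Get 7 (Reg 5) (Reg 9))),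
  Put 7 (Reg 12) (Reg 9) (Incr (Get 7 (Reg 12) (Reg 9)))]"

definition "search_test = Less (Reg 9) (Reg 10)"

definition "search_prep = Block [
  Assign 6 (Decr (Reg 6)),
  Assign 8 (Vec 6 (Reg 6)),
  Assign 5 (Load (Mul (Const 2) (Reg 8))),
  Assign 12 (Load (Incr (Mul (Const 2) (Reg 8)))),
  Assign 9 (Const 1),
  Assign 11 (Reg 10)]"

definition "color_com =
  Store (Add (Mul (Const 2) (Reg 1)) (Reg 8)) (Sub (Incr (Reg 9)) (Reg 10))"

definition "phase2_body = Seq search_prep (Seq (While search_test search_body) color_com)"

definition "phase2_test = Less (Const 0) (Reg 6)"

definition "phase1_prep = Assign 7 (Const 1)"

definition "leaves_prep = Assign 10 (Const 1)"

definition "init_prep = Assign 2 (Mul (Const 3) (Reg 1))"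

definition "program =
  Seq init_prep (Seq (While init_test init_body)
  (Seq phase1_prep (Seq (While phase1_test phase1_body)
  (Seq leaves_prep (Seq (While leaves_test leaves_body)
  (While phase2_test phase2_body))))))"

section \<open>Simulation\<close>

text \<open>The sum of the coefficients of 1, \<open>m\<close>, \<open>H\<close> and
  \<open>m * H\<close> in the total time. The factors 2 and 8 are the half-edges and the initial
  first-phase potential per edge.\<close>

definition time_const :: nat where
  "time_const = max_time init_prep + 2 * (1 + bcost init_test + max_time init_body) + 1 + bcost init_test
    + max_time phase1_prep + 8 * (1 + bcost phase1_test + max_time phase1_body) + 1 + bcost phase1_test
    + max_time leaves_prep + (1 + bcost leaves_test + max_time leaves_body) + 1 + bcost leaves_test
    + (1 + bcost phase2_test + max_time search_prep + 1 + bcost search_test + max_time color_com)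
    + (1 + bcost search_test + max_time search_body) + 1 + bcost phase2_test"

text \<open>The base is at least 2, so ten factors of it absorb numeric constants up to
  \<open>2 ^ 10\<close>; two more cover the quadratic addresses. The exponent 16 leaves
  room.\<close>

locale word_ram = graph_input +
  fixes w :: nat
  assumes word: "(n + length ps + 2) ^ 16 \<le> 2 ^ w"
begin

abbreviation "N \<equiv> n + m + 2"

lemma pow_bound: "i \<le> 16 \<Longrightarrow> N ^ i \<le> 2 ^ w"
  using word power_increasing[of i 16 N] unfolding m_def by linarith

lemma w_pos [simp]: "0 < w"
  using pow_bound[of 1] by (cases w) auto

lemma small_mod [simp]: "x \<le> 1000 * N \<Longrightarrow> x mod 2 ^ w = x"
proof -
  assume "x \<le> 1000 * N"
  also have "1000 * N < 2 ^ 10 * N" by simp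
  also have "2 ^ 10 * N \<le> N ^ 10 * N" by (intro mult_right_mono power_mono) auto
  also have "\<dots> = N ^ (10 + 1)" by (simp only: power_add power_one_right)
  also have "\<dots> \<le> 2 ^ w" by (rule pow_bound) simp
  finally show ?thesis by simp
qed

text \<open>First indices are vertices, edges and degrees; second indices are stack positions and
  heap nodes, at most about \<open>8 * m\<close>. The coefficients add up to 930, below
  1000.\<close>

lemma cell_bound:
  assumes "k < 9" "i \<le> 2 * N" "j \<le> 8 * N"
  shows "cell m k i j < 2 ^ w"
proof -
  have N2: "1 \<le> N * N" "N \<le> N * N" by simp_all
  have "(i + j) * (i + j) \<le> (10 * N) * (10 * N)" using assms by (intro mult_le_mono) auto
  also have "\<dots> = 100 * (N * N)" by (simp only: mult_ac)
  finally have le: "(i + j) * (i + j) \<le> 100 * (N * N)" .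
  define P where "P = (i + j) * (i + j)"
  define Q where "Q = N * N"
  have "P \<le> 100 * Q" unfolding P_def Q_def by (rule le)
  then have "3 * m + (9 * (P + i) + k) < 3 * N + (9 * (100 * Q + 2 * N) + 9)"
    using assms by simp
  then have "cell m k i j < 3 * N + (9 * (100 * (N * N) + 2 * N) + 9)"
    by (simp only: P_def Q_def cell_def)
  also have "\<dots> \<le> 1000 * (N * N)" using N2 unfolding Q_def[symmetric] by simp
  also have "\<dots> \<le> 2 ^ 10 * (N * N)" by (rule mult_right_mono) simp_all
  also have "\<dots> \<le> N ^ 10 * (N * N)" by (intro mult_right_mono power_mono) auto
  also have "\<dots> = N ^ (10 + 2)" by (simp only: power_add power2_eq_square)
  also have "\<dots> \<le> 2 ^ w" by (rule pow_bound) simp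
  finally show ?thesis .
qed

text \<open>Reduction modulo \<open>2 ^ w\<close> commutes with addition and multiplication, so only
  the final address has to fit into a word.\<close>

lemma aval_Cell [simp]:
  assumes "regs s 2 = 3 * m" "k < 9" "aval w a s \<le> 2 * N" "aval w b s \<le> 8 * N"
  shows "aval w (Cell k a b) s = cell m k (aval w a s) (aval w b s)"
proof -
  have "aval w (Cell k a b) s = cell m k (aval w a s) (aval w b s) mod 2 ^ w"
    unfolding Cell_def cell_def by (simp only: aval.simps assms(1) mod_simps)
  then show ?thesis using cell_bound[OF assms(2-4)] by simp
qed

lemma mem_cell [simp]: "mem s (cell m k i j) = arr m s k i j"
  by (simp add: arr_def)

lemma arr_0 [simp]: "arr m s k i 0 = vec m s k i"
  by (simp add: vec_def)

lemma mem_set_cell [simp]: "a < 3 * m \<Longrightarrow> mem (set_mem (cell m k i j) x s) a = mem s a"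
  by (auto simp: mem_set_mem cell_def)

lemma cell_not_low [simp]: "\<not> cell m k i j < 3 * m" by (simp add: cell_def)

definition input :: "store \<Rightarrow> bool" where
  "input s \<longleftrightarrow> regs s 1 = m \<and> regs s 2 = 3 * m \<and> (\<forall>h<2*m. mem s h = vt h)"

lemma input_set_reg: "input s \<Longrightarrow> r \<noteq> 1 \<Longrightarrow> r \<noteq> 2 \<Longrightarrow> input (set_reg r x s)"
  by (simp add: input_def)

lemma input_set_cell: "input s \<Longrightarrow> input (set_mem (cell m k i j) x s)"
  by (simp add: input_def)

lemma final_push:
  assumes "input s" "regs s 5 = v" "regs s 9 = x" "v \<le> N" "x \<le> 2 * N" "vec m s 3 x \<le> 8 * m + 1"
  shows "final w push_com s =
    set_mem (cell m 3 x 0) (Suc (vec m s 3 x)) (set_mem (cell m 4 x (vec m s 3 x)) v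
      (set_mem (cell m 0 v 0) x s))"
proof -
  have r2: "regs s 2 = 3 * m" using assms by (simp add: input_def)
  have 1: "final w (PutVec 0 (Reg 5) (Reg 9)) s = set_mem (cell m 0 v 0) x s"
    using r2 assms by simp
  have 2: "final w (Put 4 (Reg 9) (Vec 3 (Reg 9)) (Reg 5)) (set_mem (cell m 0 v 0) x s) =
     set_mem (cell m 4 x (vec m s 3 x)) v (set_mem (cell m 0 v 0) x s)"
    using r2 assms by simp
  show ?thesis unfolding push_com_def Block.simps final.simps(4) 1 2
    using r2 assms by simp
qed

section \<open>Simulation of the initialization\<close>

definition init_state :: "nat \<Rightarrow> store \<Rightarrow> bool" where
  "init_state h s \<longleftrightarrow> input s \<and> regs s 3 = h \<and> regs s 6 = 0 \<and>
     init_inv h (vec m s 0) (arr m s 8) (vec m s 2) (vec m s 3) (arr m s 4) (regs s 4) \<and>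
     vec m s 5 = (\<lambda>_. 0) \<and> arr m s 7 = (\<lambda>_ _. 0)"

lemma init_step:
  assumes I: "init_state h s" and h: "h < 2 * m"
  shows "init_state (Suc h) (final w init_body s)"
proof -
  define v where "v = vt h"
  define x where "x = Suc (vec m s 0 v)"
  have inv: "init_inv h (vec m s 0) (arr m s 8) (vec m s 2) (vec m s 3) (arr m s 4) (regs s 4)"
    and inp: "input s" and r: "regs s 3 = h" using I by (auto simp: init_state_def)
  have vn: "v < n" using vt_less[OF h] v_def by simp
  note b = init_inv_bounds[OF inv h]
  have b1: "x \<le> 2 * m" "vec m s 2 v \<le> 2 * m" using b vn x_def by (auto simp: Suc_le_eq)
  have b2: "vec m s 3 x \<le> 2 * m" using b b1 by blast
  have mv: "mem s h = v" using inp h v_def by (simp add: input_def)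
  have r2: "regs s 2 = 3 * m" using inp by (simp add: input_def)
  define s1 where "s1 = set_reg 9 x (set_mem (cell m 2 v 0) (Suc (vec m s 2 v))
     (set_mem (cell m 8 v (vec m s 2 v)) (h div 2) (set_reg 5 v s)))"
  define s2 where "s2 = set_mem (cell m 3 x 0) (Suc (vec m s 3 x)) (set_mem (cell m 4 x (vec m s 3 x)) v
      (set_mem (cell m 0 v 0) x s1))"
  define s3 where "s3 = (if regs s 4 < x then set_reg 4 x s2 else s2)"
  have inp1: "input s1" unfolding s1_def
    by (intro input_set_reg input_set_cell inp) auto
  then have inp2: "input s2" unfolding s2_def by (intro input_set_cell)
  then have inp3: "input (set_reg 3 (Suc h) s3)" unfolding s3_def by (simp add: input_set_reg)
  have regs1: "regs s1 3 = h" "regs s1 4 = regs s 4" "regs s1 9 = x" "regs s1 5 = v"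
    "regs s1 6 = regs s 6" "vec m s1 3 = vec m s 3" using r by (simp_all add: s1_def)
  have fin2: "final w push_com s1 = s2"
    using final_push[OF inp1, of v x] vn b1 b2 regs1 by (simp add: s2_def)
  have "final w init_body s = final w (Block [push_com, Ite (Less (Reg 4) (Reg 9)) (Assign 4 (Reg 9)) Skip,
       Assign 3 (Incr (Reg 3))]) s1"
    unfolding init_body_def s1_def using r mv r2 vn b1 h x_def by simp
  also have "\<dots> = set_reg 3 (Suc h) s3"
    using regs1 h by (simp add: fin2 s2_def s3_def)
  finally have fin: "final w init_body s = set_reg 3 (Suc h) s3" .
  have arr3: "arr m s3 = arr m s2" "vec m s3 = vec m s2" "regs s3 4 = (if regs s 4 < x then x else regs s 4)"
    "regs s3 6 = 0"
    using regs1 I by (simp_all add: s3_def s2_def init_state_def)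
  have arr2: "vec m s2 0 = (vec m s 0)(v := x)" "arr m s2 8 = (arr m s 8)(v := (arr m s 8 v)(vec m s 2 v := h div 2))"
    "vec m s2 2 = (vec m s 2)(v := Suc (vec m s 2 v))" "vec m s2 3 = (vec m s 3)(x := Suc (vec m s 3 x))"
    "arr m s2 4 = (arr m s 4)(x := (arr m s 4 x)(vec m s 3 x := v))"
    "vec m s2 5 = vec m s 5" "arr m s2 7 = arr m s 7"
    by (simp_all add: s2_def s1_def)
  show ?thesis
    using I init_inv_step[OF inv h v_def x_def] inp3 unfolding init_state_def fin
    by (simp add: arr3 arr2)
qed

section \<open>Simulation of the first phase\<close>

definition phase1_state :: "nat \<Rightarrow> store \<Rightarrow> bool" where
  "phase1_state D s \<longleftrightarrow> input s \<and> regs s 4 = D \<and> arr m s 7 = (\<lambda>_ _. 0) \<and>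
     phase1_inv (regs s 6) (regs s 7) (vec m s 0) (arr m s 8) (vec m s 2) (vec m s 3) (arr m s 4)
       (vec m s 5) (vec m s 6) \<and>
     pot (regs s 6) (regs s 7) (vec m s 2) (vec m s 3) \<le> 8 * m"

abbreviation store_pot :: "store \<Rightarrow> nat" where
  "store_pot s \<equiv> pot (regs s 6) (regs s 7) (vec m s 2) (vec m s 3)"

lemma final_decr:
  assumes "input s" "regs s 5 = v" "v \<le> N" "vec m s 0 v \<le> N" "x = vec m s 0 v - 1"
    "vec m s 3 x \<le> 8 * m + 1"
  shows "final w decr_com s =
    set_mem (cell m 3 x 0) (Suc (vec m s 3 x)) (set_mem (cell m 4 x (vec m s 3 x)) v
      (set_mem (cell m 0 v 0) x (set_reg 9 x s)))"
proof -
  have r2: "regs s 2 = 3 * m" using assms by (simp add: input_def)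
  have 1: "final w (Assign 9 (Decr (Vec 0 (Reg 5)))) s = set_reg 9 x s"
    using r2 assms by simp
  have "input (set_reg 9 x s)" using assms(1) by (rule input_set_reg) auto
  from final_push[OF this, of v x] show ?thesis
    unfolding decr_com_def final.simps(4) 1 using assms by simp
qed

lemma final_remove:
  assumes inp: "input s" and v: "regs s 8 = e" "e < m" and k: "regs s 6 = k" "k < m"
    and d: "regs s 7 = d" "d \<le> m + 1"
    and p: "p = vt (2 * e)" and q: "q = vt (2 * e + 1)"
    and x: "x = vec m s 0 p - 1" and y: "y = vec m s 0 q - 1"
    and dg: "vec m s 0 p \<le> m" "vec m s 0 q \<le> m"
    and bc1: "bc1 = (vec m s 3)(x := Suc (vec m s 3 x))"
    and bc: "vec m s 3 x \<le> 8 * m" "vec m s 3 y \<le> 8 * m"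
    and s': "s' = final w remove_com s"
  shows "input s'" "regs s' 4 = regs s 4" "arr m s' 7 = arr m s 7" "regs s' 6 = Suc k"
    "regs s' 7 = 1 + (d - 2)" "vec m s' 0 = (vec m s 0)(p := x, q := y)" "arr m s' 8 = arr m s 8"
    "vec m s' 2 = vec m s 2" "vec m s' 3 = bc1(y := Suc (bc1 y))"
    "arr m s' 4 = ((arr m s 4)(x := (arr m s 4 x)(vec m s 3 x := p)))
       (y := (((arr m s 4)(x := (arr m s 4 x)(vec m s 3 x := p))) y)(bc1 y := q))"
    "vec m s' 5 = (vec m s 5)(e := 1)" "vec m s' 6 = (vec m s 6)(k := e)"
proof -
  have pq: "p < n" "q < n" "p \<noteq> q" using ed_props[OF v(2)] p q by auto
  have r2: "regs s 2 = 3 * m" using inp by (simp add: input_def)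
  define s1 where "s1 = set_reg 6 (Suc k) (set_mem (cell m 6 k 0) e (set_mem (cell m 5 e 0) 1 s))"
  define s2 where "s2 = set_reg 5 p s1"
  define s3 where "s3 = set_mem (cell m 3 x 0) (Suc (vec m s 3 x)) (set_mem (cell m 4 x (vec m s 3 x)) p
      (set_mem (cell m 0 p 0) x (set_reg 9 x s2)))"
  define s4 where "s4 = set_reg 5 q s3"
  define s5 where "s5 = set_mem (cell m 3 y 0) (Suc (bc1 y)) (set_mem (cell m 4 y (bc1 y)) q
      (set_mem (cell m 0 q 0) y (set_reg 9 y s4)))"
  have i1: "input s1" unfolding s1_def by (intro input_set_reg input_set_cell inp) auto
  have i2: "input s2" unfolding s2_def by (intro input_set_reg i1) auto
  have i3: "input s3" unfolding s3_def by (intro input_set_reg input_set_cell i2) auto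
  have i4: "input s4" unfolding s4_def by (intro input_set_reg i3) auto
  have i5: "input s5" unfolding s5_def by (intro input_set_reg input_set_cell i4) auto
  have r1: "regs s1 8 = e" "regs s3 8 = e" "regs s5 7 = d" "regs s5 4 = regs s 4" "regs s5 6 = Suc k"
    using v d by (simp_all add: s1_def s2_def s3_def s4_def s5_def)
  have m1: "mem s1 (2 * e) = p" "mem s3 (Suc (2 * e)) = q"
    using i1 i3 v p q by (auto simp: input_def)
  have v2: "vec m s2 0 = vec m s 0" "vec m s2 3 = vec m s 3" "regs s2 5 = p"
    by (simp_all add: s1_def s2_def)
  have v4: "vec m s4 0 = (vec m s 0)(p := x)" "vec m s4 3 = bc1" "regs s4 5 = q"
    using v2 by (simp_all add: s3_def s4_def bc1)
  \<comment> \<open>If both endpoints get the same new degree, the first push has already raised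
    this height by one.\<close>
  have bcy: "bc1 y \<le> 8 * m + 1" using bc bc1 by auto
  have f1: "final w (Block [PutVec 5 (Reg 8) (Const 1), PutVec 6 (Reg 6) (Reg 8), Assign 6 (Incr (Reg 6))]) s = s1"
    unfolding s1_def using r2 v k by simp
  have f2: "final w (Assign 5 (Load (Mul (Const 2) (Reg 8)))) s1 = s2"
    unfolding s2_def using r1 m1 v by simp
  have f3: "final w decr_com s2 = s3"
    using final_decr[OF i2, of p x] v2 pq dg bc x by (simp add: s3_def)
  have f4: "final w (Assign 5 (Load (Incr (Mul (Const 2) (Reg 8))))) s3 = s4"
    unfolding s4_def using r1 m1 v by simp
  have f5: "final w decr_com s4 = s5"
    using final_decr[OF i4, of q y] v4 pq dg bcy y by (simp add: s5_def)
  have f6: "final w (Assign 7 (Add (Const 1) (Sub (Reg 7) (Const 2)))) s5 = set_reg 7 (1 + (d - 2)) s5"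
    using r1 d by simp
  have "final w remove_com s = final w (Block [Assign 5 (Load (Mul (Const 2) (Reg 8))),
      decr_com, Assign 5 (Load (Incr (Mul (Const 2) (Reg 8)))), decr_com,
      Assign 7 (Add (Const 1) (Sub (Reg 7) (Const 2)))])
      (final w (Block [PutVec 5 (Reg 8) (Const 1), PutVec 6 (Reg 6) (Reg 8), Assign 6 (Incr (Reg 6))]) s)"
    unfolding remove_com_def by (simp only: Block.simps final.simps(4))
  also have "\<dots> = set_reg 7 (1 + (d - 2)) s5"
    unfolding f1 by (simp only: Block.simps final.simps(4) f2 f3 f4 f5 f6)
  finally have s': "s' = set_reg 7 (1 + (d - 2)) s5" using s' by simp
  show "input s'" unfolding s' by (intro input_set_reg i5) auto
  show "regs s' 4 = regs s 4" "regs s' 6 = Suc k" "regs s' 7 = 1 + (d - 2)"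
    using r1 by (simp_all add: s')
  show "arr m s' 7 = arr m s 7" "arr m s' 8 = arr m s 8" "vec m s' 2 = vec m s 2"
    "vec m s' 5 = (vec m s 5)(e := 1)" "vec m s' 6 = (vec m s 6)(k := e)"
    by (simp_all add: s' s5_def s4_def s3_def s2_def s1_def)
  show "vec m s' 0 = (vec m s 0)(p := x, q := y)" "vec m s' 3 = bc1(y := Suc (bc1 y))"
    using v4 by (simp_all add: s' s5_def)
  have "arr m s4 4 = (arr m s 4)(x := (arr m s 4 x)(vec m s 3 x := p))"
    by (simp add: s4_def s3_def s2_def s1_def)
  then show "arr m s' 4 = ((arr m s 4)(x := (arr m s 4 x)(vec m s 3 x := p)))
       (y := (((arr m s 4)(x := (arr m s 4 x)(vec m s 3 x := p))) y)(bc1 y := q))"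
    by (simp add: s' s5_def)
qed

lemma phase1_step:
  assumes P: "phase1_state D s" and k: "regs s 6 < m"
  shows "phase1_state D (final w phase1_body s) \<and> Suc (store_pot (final w phase1_body s)) \<le> store_pot s"
proof -
  let ?k = "regs s 6" and ?d = "regs s 7" and ?dg = "vec m s 0" and ?ap = "vec m s 2" and ?bc = "vec m s 3"
  have inp: "input s" and inv: "phase1_inv ?k ?d ?dg (arr m s 8) ?ap ?bc (arr m s 4) (vec m s 5) (vec m s 6)"
    and pot: "store_pot s \<le> 8 * m" and r4: "regs s 4 = D" and T: "arr m s 7 = (\<lambda>_ _. 0)"
    using P by (auto simp: phase1_state_def)
  have r2: "regs s 2 = 3 * m" using inp by (simp add: input_def)
  have d: "?d \<le> m + 1" "1 \<le> ?d" using inv by (auto simp: phase1_inv_def)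
  have bcd: "?bc ?d \<le> 8 * m" using phase1_bounds(2)[OF pot, of ?d] d k by auto
  have test: "bval w (Eq (Vec 3 (Reg 7)) (Const 0)) s \<longleftrightarrow> ?bc ?d = 0" using r2 d by simp
  show ?thesis
  proof (cases "?bc ?d = 0")
    case True
    have fin: "final w phase1_body s = set_reg 7 (Suc ?d) s"
      unfolding phase1_body_def final.simps(5) test using True d by simp
    show ?thesis
      using phase1_advance[OF inv k True] pot r4 T input_set_reg[OF inp, of 7 "Suc ?d"]
      unfolding phase1_state_def fin by simp
  next
    case False
    then have bc0: "0 < ?bc ?d" by simp
    define v where "v = arr m s 4 ?d (?bc ?d - 1)"
    define s1 where "s1 = set_reg 5 v s"
    have i1: "input s1" unfolding s1_def by (intro input_set_reg inp) auto
    have s1: "regs s1 5 = v" "regs s1 7 = ?d" "regs s1 6 = ?k" "regs s1 4 = D" "regs s1 2 = 3 * m"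
      "vec m s1 = vec m s" "arr m s1 = arr m s"
      using r4 r2 by (simp_all add: s1_def)
    have vn: "v < n" using inv bc0 unfolding phase1_inv_def buckets_def v_def by simp
    have dgv: "?dg u \<le> m" for u using phase1_dg_le[OF inv] .
    have "final w (Assign 5 (Get 4 (Reg 7) (Decr (Vec 3 (Reg 7))))) s = s1"
      unfolding s1_def v_def using r2 d bcd by simp
    then have fin: "final w phase1_body s = final w (Ite (Eq (Vec 0 (Reg 5)) (Reg 7))
       (Block [
         PutVec 2 (Reg 5) (Decr (Vec 2 (Reg 5))),
         Assign 8 (Get 8 (Reg 5) (Vec 2 (Reg 5))),
         Ite (Eq (Vec 5 (Reg 8)) (Const 0)) remove_com Skip])
       (PutVec 3 (Reg 7) (Decr (Vec 3 (Reg 7))))) s1"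
      unfolding phase1_body_def final.simps(5)[of _ "Eq (Vec 3 (Reg 7)) (Const 0)"] test final.simps(4)
      using False by (simp only: if_False)
    have test2: "bval w (Eq (Vec 0 (Reg 5)) (Reg 7)) s1 \<longleftrightarrow> ?dg v = ?d" using s1 vn by simp
    show ?thesis
    proof (cases "?dg v = ?d")
      case dg: False
      have fin: "final w phase1_body s = set_mem (cell m 3 ?d 0) (?bc ?d - 1) s1"
        unfolding fin final.simps(5) test2 using dg s1 d by simp
      show ?thesis
        using phase1_stale[OF inv k bc0 dg[unfolded v_def]] pot T input_set_cell[OF i1, of 3 ?d 0 "?bc ?d - 1"]
        unfolding phase1_state_def fin by (simp add: s1)
    next
      case dg: True
      define e where "e = arr m s 8 v (?ap v - 1)"
      note c = phase1_current[OF inv bc0 v_def dg e_def]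
      define s2 where "s2 = set_reg 8 e (set_mem (cell m 2 v 0) (?ap v - 1) s1)"
      have i2: "input s2" unfolding s2_def by (intro input_set_reg input_set_cell i1) auto
      have s2: "regs s2 7 = ?d" "regs s2 6 = ?k" "regs s2 4 = D" "regs s2 8 = e" "regs s2 2 = 3 * m"
        "vec m s2 0 = ?dg" "vec m s2 2 = ?ap(v := ?ap v - 1)" "vec m s2 3 = ?bc" "vec m s2 5 = vec m s 5"
        "vec m s2 6 = vec m s 6" "arr m s2 4 = arr m s 4" "arr m s2 7 = arr m s 7" "arr m s2 8 = arr m s 8"
        using s1 by (simp_all add: s2_def)
      have apv: "?ap v \<le> 8 * m" using phase1_bounds(1)[OF pot c(1)] .
      have f1: "final w (PutVec 2 (Reg 5) (Decr (Vec 2 (Reg 5)))) s1 = set_mem (cell m 2 v 0) (?ap v - 1) s1"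
        using s1 vn by simp
      have f2: "final w (Assign 8 (Get 8 (Reg 5) (Vec 2 (Reg 5)))) (set_mem (cell m 2 v 0) (?ap v - 1) s1) = s2"
        unfolding s2_def e_def using s1 vn apv by simp
      have test3: "bval w (Eq (Vec 5 (Reg 8)) (Const 0)) s2 \<longleftrightarrow> vec m s 5 e = 0" using s2 c by simp
      have fin: "final w phase1_body s = (if vec m s 5 e = 0 then final w remove_com s2 else s2)"
        unfolding fin final.simps(5) test2 using dg
        by (simp only: if_True simp_thms Block.simps final.simps(1,4,5) f1 f2 test3)
      show ?thesis
      proof (cases "vec m s 5 e = 0")
        case rm: False
        show ?thesis
          using phase1_dead[OF inv bc0 v_def dg e_def rm] pot T i2 rm
          unfolding phase1_state_def fin by (simp add: s2)
      next
        case rm: True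
        define s' where "s' = final w remove_com s2"
        define p where "p = vt (2 * e)"
        define q where "q = vt (2 * e + 1)"
        define x where "x = ?dg p - 1"
        define y where "y = ?dg q - 1"
        define bc1 where "bc1 = ?bc(x := Suc (?bc x))"
        have xy: "x \<le> 2 * m" "y \<le> 2 * m" using dgv[of p] dgv[of q] x_def y_def by auto
        note b = phase1_bounds(2)[OF pot xy(1)] phase1_bounds(2)[OF pot xy(2)]
        note f = final_remove[OF i2 s2(4) c(3) s2(2) k s2(1) d(1) p_def q_def, unfolded s2,
            OF x_def y_def dgv dgv bc1_def b s'_def, unfolded s2]
        note z = phase1_remove[OF inv k bc0 v_def dg e_def rm p_def q_def x_def y_def bc1_def refl refl refl]
        have "final w phase1_body s = s'" using fin rm s'_def by simp
        then show ?thesis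
          unfolding phase1_state_def using z f pot T by (simp only: simp_thms)
      qed
    qed
  qed
qed

section \<open>Simulation of the second phase\<close>

definition phase2_state :: "nat \<Rightarrow> nat \<Rightarrow> (nat \<Rightarrow> nat) \<Rightarrow> store \<Rightarrow> bool" where
  "phase2_state h k out s \<longleftrightarrow> input s \<and> regs s 6 = k \<and> regs s 10 = 2 ^ h \<and>
     (\<forall>e<m. mem s (2 * m + e) = out e) \<and> phase2_inv h (vec m s 6) k (arr m s 7) out"

definition search_state :: "nat \<Rightarrow> nat \<Rightarrow> (nat \<Rightarrow> nat) \<Rightarrow> (nat \<Rightarrow> nat) \<Rightarrow> nat \<Rightarrow> store \<Rightarrow> bool" where
  "search_state h k st out i s \<longleftrightarrow> input s \<and> regs s 6 = k - 1 \<and> regs s 10 = 2 ^ h \<and>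
     regs s 8 = st (k - 1) \<and> regs s 5 = vt (2 * st (k - 1)) \<and> regs s 12 = vt (2 * st (k - 1) + 1) \<and>
     vec m s 6 = st \<and> (\<forall>e<m. mem s (2 * m + e) = out e) \<and>
     search_inv h out (st ` {k..<m}) (st (k - 1)) i (regs s 9) (regs s 11) (arr m s 7)"

lemma search_prep_state:
  assumes P: "phase2_state h k out s" and k: "0 < k" and D: "\<And>v. degree E v \<le> D" "2 * D \<le> 2 ^ h"
  shows "search_state h k (vec m s 6) out 0 (final w search_prep s)"
proof -
  define e where "e = vec m s 6 (k - 1)"
  have inp: "input s" and r: "regs s 6 = k" "regs s 10 = 2 ^ h"
    and inv: "phase2_inv h (vec m s 6) k (arr m s 7) out" and out: "\<forall>e<m. mem s (2 * m + e) = out e"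
    using P by (auto simp: phase2_state_def)
  have r2: "regs s 2 = 3 * m" using inp by (simp add: input_def)
  note S = search_start[OF inv k e_def D]
  have km: "k \<le> m" using inv by (simp add: phase2_inv_def)
  have mm: "mem s (2 * e) = vt (2 * e)" "mem s (Suc (2 * e)) = vt (Suc (2 * e))"
    using inp S(2) by (auto simp: input_def)
  have fin: "final w search_prep s = set_reg 11 (2 ^ h) (set_reg 9 1 (set_reg 12 (vt (Suc (2 * e)))
     (set_reg 5 (vt (2 * e)) (set_reg 8 e (set_reg 6 (k - 1) s)))))"
    using r r2 km k S(2) mm e_def unfolding search_prep_def by simp
  have "input (final w search_prep s)" unfolding fin by (intro input_set_reg inp) auto
  then show ?thesis unfolding search_state_def fin e_def[symmetric] using r S(1) out by (simp add: e_def)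
qed

lemma search_body_state:
  assumes P: "search_state h k st out i s" and x: "regs s 9 < regs s 10"
    and em: "st (k - 1) < m" and K: "st ` {k..<m} \<subseteq> {..<m}" and L: "2 ^ h \<le> 4 * m + 1"
  shows "search_state h k st out (Suc i) (final w search_body s)" "i < h"
proof -
  define e where "e = st (k - 1)"
  define u where "u = vt (2 * e)"
  define v where "v = vt (2 * e + 1)"
  let ?x = "regs s 9" and ?T = "arr m s 7"
  have inp: "input s" and r: "regs s 10 = 2 ^ h" "regs s 8 = e" "regs s 5 = u" "regs s 12 = v"
    and inv: "search_inv h out (st ` {k..<m}) e i ?x (regs s 11) ?T"
    using P by (auto simp: search_state_def e_def u_def v_def)
  have r2: "regs s 2 = 3 * m" using inp by (simp add: input_def)
  have em: "e < m" using em e_def by simp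
  have uv: "u < n" "v < n" "u \<noteq> v" using ed_props[OF em] u_def v_def by auto
  have xh: "?x < 2 ^ h" using x r by simp
  \<comment> \<open>The children are then at most \<open>8 * m + 1\<close>, within the range of
    second indices.\<close>
  have xb: "?x \<le> 4 * m" using xh L by linarith
  note Tb = search_bounds[OF inv xh em K]
  define p' where "p' = regs s 11 div 2"
  define x' where "x' = (if ?T u (2 * ?x) + ?T v (2 * ?x) < p' then 2 * ?x else 2 * ?x + 1)"
  have x'b: "x' \<le> 8 * m + 1" "2 * ?x \<le> x'" using xb x'_def by auto
  define s1 where "s1 = set_reg 11 p' (set_reg 9 (2 * ?x) s)"
  define s2 where "s2 = (if ?T u (2 * ?x) + ?T v (2 * ?x) < p' then s1 else set_reg 9 x' s1)"
  define s3 where "s3 = set_mem (cell m 7 u x') (Suc (?T u x')) s2"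
  define s4 where "s4 = set_mem (cell m 7 v x') (Suc (?T v x')) s3"
  have s1: "regs s1 9 = 2 * ?x" "regs s1 11 = p'" "regs s1 2 = 3 * m" "regs s1 5 = u" "regs s1 12 = v"
    "arr m s1 = arr m s"
    using r r2 by (simp_all add: s1_def)
  have s2: "regs s2 9 = x'" "regs s2 2 = 3 * m" "regs s2 5 = u" "regs s2 12 = v" "arr m s2 = arr m s"
     "regs s2 11 = p'"
    using s1 by (simp_all add: s2_def x'_def)
  have s3: "regs s3 9 = x'" "regs s3 2 = 3 * m" "regs s3 5 = u" "regs s3 12 = v"
    "arr m s3 7 = ?T(u := (?T u)(x' := Suc (?T u x')))"
    using s2 by (simp_all add: s3_def)
  have f1: "final w (Assign 11 (Div (Reg 11) (Const 2))) (final w (Assign 9 (Mul (Const 2) (Reg 9))) s) = s1"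
    unfolding s1_def p'_def using xb by simp
  have f2: "final w (Ite (Less (Add (Get 7 (Reg 5) (Reg 9)) (Get 7 (Reg 12) (Reg 9))) (Reg 11)) Skip
    (Assign 9 (Incr (Reg 9)))) s1 = s2"
    using s1 uv xb Tb[of "2 * ?x" u] Tb[of "2 * ?x" v] by (simp add: s2_def x'_def)
  have f3: "final w (Put 7 (Reg 5) (Reg 9) (Incr (Get 7 (Reg 5) (Reg 9)))) s2 = s3"
    using s2 uv x'b Tb[of x' u] by (simp add: s3_def)
  have f4: "final w (Put 7 (Reg 12) (Reg 9) (Incr (Get 7 (Reg 12) (Reg 9)))) s3 = s4"
    using s3 uv x'b Tb[of x' v] by (simp add: s4_def)
  have fin: "final w search_body s = s4"
    unfolding search_body_def by (simp only: Block.simps final.simps(4) f1 f2 f3 f4)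
  have "input s1" unfolding s1_def by (intro input_set_reg inp) auto
  then have "input s2" unfolding s2_def by (simp add: input_set_reg)
  then have inp4: "input s4" unfolding s4_def s3_def by (intro input_set_cell)
  have arr4: "arr m s4 7 = ?T(u := (?T u)(x' := Suc (?T u x')), v := (?T v)(x' := Suc (?T v x')))"
    using s3 uv by (simp add: s4_def)
  note step = search_step[OF inv xh em K u_def v_def p'_def x'_def refl, folded arr4]
  show "i < h" using step(2) .
  have "regs s4 6 = regs s 6" "regs s4 10 = regs s 10" "regs s4 8 = regs s 8" "regs s4 5 = regs s 5"
    "regs s4 12 = regs s 12" "vec m s4 6 = vec m s 6" "\<forall>e<m. mem s4 (2 * m + e) = mem s (2 * m + e)"
    "regs s4 9 = x'" "regs s4 11 = p'"
    using s2(1,6) by (simp_all add: s4_def s3_def) (simp_all add: s2_def s1_def)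
  then show "search_state h k st out (Suc i) (final w search_body s)"
    using P step(1) inp4 unfolding search_state_def fin e_def[symmetric] by simp
qed

lemma color_state:
  assumes P: "phase2_state h k out s0" and k: "0 < k"
    and S: "search_state h k (vec m s0 6) out i s" and x: "\<not> regs s 9 < regs s 10"
    and L: "2 ^ h \<le> 4 * m + 1"
  shows "\<exists>out'. phase2_state h (k - 1) out' (final w color_com s)"
proof -
  define e where "e = vec m s0 6 (k - 1)"
  have inv: "phase2_inv h (vec m s0 6) k (arr m s0 7) out" using P by (simp add: phase2_state_def)
  have em: "e < m" using inv k by (auto simp: phase2_inv_def e_def)
  have inp: "input s" and r: "regs s 10 = 2 ^ h" "regs s 8 = e" "regs s 6 = k - 1" "vec m s 6 = vec m s0 6"
    and out: "\<forall>e<m. mem s (2 * m + e) = out e"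
    and sinv: "search_inv h out (vec m s0 6 ` {k..<m}) e i (regs s 9) (regs s 11) (arr m s 7)"
    using S by (auto simp: search_state_def e_def)
  have r1: "regs s (Suc 0) = m" using inp by (simp add: input_def)
  have "2 ^ h \<le> regs s 9" using x r by simp
  note E = search_end[OF inv k e_def sinv this]
  \<comment> \<open>The leaf is bounded linearly in \<open>m\<close>, so computing its color does
    not wrap around.\<close>
  have "i \<le> h" "regs s 9 < 2 ^ (i + 1)" using sinv by (auto simp: search_inv_def)
  moreover have "(2::nat) ^ (i + 1) \<le> 2 ^ (h + 1)" using \<open>i \<le> h\<close> by (intro power_increasing) auto
  moreover have "(2::nat) ^ (h + 1) = 2 * 2 ^ h" by simp
  ultimately have "regs s 9 \<le> 8 * m + 2" using L by linarith
  then have fin: "final w color_com s = set_mem (2 * m + e) (regs s 9 + 1 - 2 ^ h) s"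
    using r r1 em unfolding color_com_def by simp
  have "input (final w color_com s)" unfolding fin using inp em by (auto simp: input_def mem_set_mem)
  moreover have "arr m (final w color_com s) = arr m s" "vec m (final w color_com s) = vec m s"
    unfolding fin using em by auto
  moreover have "\<forall>f<m. mem (final w color_com s) (2 * m + f) = (out(e := regs s 9 + 1 - 2 ^ h)) f"
    unfolding fin using out by (simp add: mem_set_mem)
  ultimately have "phase2_state h (k - 1) (out(e := regs s 9 + 1 - 2 ^ h)) (final w color_com s)"
    using E r unfolding phase2_state_def by (simp add: fin)
  then show ?thesis by blast
qed

section \<open>Running times of the loops\<close>

abbreviation loop_cost :: "bexp \<Rightarrow> com \<Rightarrow> nat" where
  "loop_cost b c \<equiv> 1 + bcost b + max_time c"

definition phase2_cost :: "nat \<Rightarrow> nat" where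
  "phase2_cost h = max_time search_prep + 1 + bcost search_test + max_time color_com
     + h * loop_cost search_test search_body"

lemma phase2_body_exec:
  assumes P: "phase2_state h k out s" and k: "0 < k"
    and D: "\<And>v. degree E v \<le> D" "2 * D \<le> 2 ^ h" and L: "2 ^ h \<le> 4 * m + 1"
  shows "\<exists>t s' out'. exec w phase2_body s t s' \<and> t \<le> phase2_cost h \<and> phase2_state h (k - 1) out' s'"
proof -
  let ?st = "vec m s 6"
  have inv: "phase2_inv h ?st k (arr m s 7) out" using P by (simp add: phase2_state_def)
  have em: "?st (k - 1) < m" using inv k by (auto simp: phase2_inv_def)
  have K: "?st ` {k..<m} \<subseteq> {..<m}"
    using inv unfolding phase2_inv_def by (metis image_mono ivl_subset lessThan_atLeast0 le0 le_refl)
  have "loop_free search_prep" by (simp add: search_prep_def)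
  then obtain t1 where t1: "t1 \<le> max_time search_prep" "exec w search_prep s t1 (final w search_prep s)"
    using exec_final by blast
  \<comment> \<open>Each iteration descends one level, so the budget is the remaining depth times
    the cost of an iteration.\<close>
  define I where "I = (\<lambda>q s'. \<exists>i. search_state h k ?st out i s' \<and>
    q = (h - i) * loop_cost search_test search_body)"
  have I0: "I (h * loop_cost search_test search_body) (final w search_prep s)"
    unfolding I_def using search_prep_state[OF P k D] by (intro exI[of _ 0]) simp
  have lf: "loop_free search_body" by (simp add: search_body_def)
  have "\<exists>t s'' q'. exec w search_body s' t s'' \<and> I q' s'' \<and> 1 + bcost search_test + t + q' \<le> q"
    if I: "I q s'" and b: "bval w search_test s'" for q s'
  proof -
    obtain i where i: "search_state h k ?st out i s'" "q = (h - i) * loop_cost search_test search_body"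
      using I I_def by auto
    have x: "regs s' 9 < regs s' 10" using b by (simp add: search_test_def)
    note b = search_body_state[OF i(1) x em K L]
    obtain t where "t \<le> max_time search_body" "exec w search_body s' t (final w search_body s')"
      using exec_final[OF lf] by blast
    moreover have "I ((h - Suc i) * loop_cost search_test search_body) (final w search_body s')"
      unfolding I_def using b(1) by blast
    moreover have "(h - i) * loop_cost search_test search_body =
       loop_cost search_test search_body + (h - Suc i) * loop_cost search_test search_body"
      using b(2) by (simp add: Suc_diff_Suc[symmetric])
    ultimately show ?thesis using i(2)
      by (intro exI[of _ t] exI[of _ "final w search_body s'"]
          exI[of _ "(h - Suc i) * loop_cost search_test search_body"]) simp
  qed
  from exec_While[of I w search_test search_body, OF this I0]
  obtain t2 s2 q2 where 2: "exec w (While search_test search_body) (final w search_prep s) t2 s2"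
    "t2 \<le> h * loop_cost search_test search_body + 1 + bcost search_test" "I q2 s2" "\<not> bval w search_test s2"
    by blast
  obtain i where i: "search_state h k ?st out i s2" using 2(3) I_def by auto
  have x: "\<not> regs s2 9 < regs s2 10" using 2(4) by (simp add: search_test_def)
  have "loop_free color_com" by (simp add: color_com_def)
  then obtain t3 where t3: "t3 \<le> max_time color_com" "exec w color_com s2 t3 (final w color_com s2)"
    using exec_final by blast
  have "exec w phase2_body s (t1 + (t2 + t3)) (final w color_com s2)"
    unfolding phase2_body_def by (rule exec.Seq[OF t1(2) exec.Seq[OF 2(1) t3(2)]])
  moreover have "t1 + (t2 + t3) \<le> phase2_cost h"
    using t1(1) 2(2) t3(1) by (simp add: phase2_cost_def)
  ultimately show ?thesis using color_state[OF P k i x L] by blast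
qed

lemma phase2_exec:
  assumes P: "phase2_state h m out s"
    and D: "\<And>v. degree E v \<le> D" "2 * D \<le> 2 ^ h" and L: "2 ^ h \<le> 4 * m + 1"
  shows "\<exists>t s'. exec w (While phase2_test phase2_body) s t s' \<and>
    t \<le> m * (1 + bcost phase2_test + phase2_cost h) + 1 + bcost phase2_test \<and>
    cg_returns E (output_coloring ps s')"
proof -
  let ?c = "1 + bcost phase2_test + phase2_cost h"
  define I where "I = (\<lambda>q s'. \<exists>k out. phase2_state h k out s' \<and> q = k * ?c)"
  have I0: "I (m * ?c) s" unfolding I_def using P by blast
  have "\<exists>t s'' q'. exec w phase2_body s' t s'' \<and> I q' s'' \<and> 1 + bcost phase2_test + t + q' \<le> q"
    if I: "I q s'" and b: "bval w phase2_test s'" for q s'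
  proof -
    obtain k out where i: "phase2_state h k out s'" "q = k * ?c" using I I_def by auto
    have k: "0 < k" using b i(1) by (simp add: phase2_test_def phase2_state_def)
    obtain t s'' out' where 1: "exec w phase2_body s' t s''" "t \<le> phase2_cost h"
      "phase2_state h (k - 1) out' s''"
      using phase2_body_exec[OF i(1) k D L] by blast
    have "I ((k - 1) * ?c) s''" unfolding I_def using 1(3) by blast
    moreover have "k * ?c = ?c + (k - 1) * ?c" using k by (cases k) auto
    ultimately show ?thesis using i(2) 1(1,2)
      by (intro exI[of _ t] exI[of _ s''] exI[of _ "(k - 1) * ?c"]) simp
  qed
  from exec_While[of I w phase2_test phase2_body, OF this I0]
  obtain t2 s2 q2 where 2: "exec w (While phase2_test phase2_body) s t2 s2"
    "t2 \<le> m * ?c + 1 + bcost phase2_test" "I q2 s2" "\<not> bval w phase2_test s2"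
    by blast
  then obtain k out' where k: "phase2_state h k out' s2" using I_def by auto
  then have "k = 0" using 2(4) by (simp add: phase2_test_def phase2_state_def)
  then have "cg_returns E (output_coloring ps s2)"
    using k phase2_end[of h "vec m s2 6" "arr m s2 7" out' s2] by (simp add: phase2_state_def)
  then show ?thesis using 2(1,2) by blast
qed

lemma init_exec:
  assumes "init_state 0 s"
  shows "\<exists>t s'. exec w (While init_test init_body) s t s' \<and>
    t \<le> 2 * m * loop_cost init_test init_body + 1 + bcost init_test \<and> init_state (2 * m) s'"
proof -
  let ?c = "loop_cost init_test init_body"
  define I where "I = (\<lambda>q s'. \<exists>h\<le>2*m. init_state h s' \<and> q = (2 * m - h) * ?c)"
  have I0: "I (2 * m * ?c) s" unfolding I_def using assms by (intro exI[of _ 0]) simp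
  have lf: "loop_free init_body" by (simp add: init_body_def push_com_def)
  have test: "bval w init_test s' \<longleftrightarrow> h < 2 * m" if "init_state h s'" for h s'
    using that by (simp add: init_test_def init_state_def input_def)
  have "\<exists>t s'' q'. exec w init_body s' t s'' \<and> I q' s'' \<and> 1 + bcost init_test + t + q' \<le> q"
    if I: "I q s'" and b: "bval w init_test s'" for q s'
  proof -
    obtain h where h: "init_state h s'" "q = (2 * m - h) * ?c" using I I_def by auto
    have hm: "h < 2 * m" using test[OF h(1)] b by simp
    obtain t where "t \<le> max_time init_body" "exec w init_body s' t (final w init_body s')"
      using exec_final[OF lf] by blast
    moreover have "I ((2 * m - Suc h) * ?c) (final w init_body s')"
      unfolding I_def using init_step[OF h(1) hm] hm by (intro exI[of _ "Suc h"]) simp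
    moreover have "(2 * m - h) * ?c = ?c + (2 * m - Suc h) * ?c"
      using hm by (simp add: Suc_diff_Suc[symmetric])
    ultimately show ?thesis using h(2)
      by (intro exI[of _ t] exI[of _ "final w init_body s'"] exI[of _ "(2 * m - Suc h) * ?c"]) simp
  qed
  from exec_While[of I w init_test init_body, OF this I0]
  obtain t2 s2 q2 where 2: "exec w (While init_test init_body) s t2 s2"
    "t2 \<le> 2 * m * ?c + 1 + bcost init_test" "I q2 s2" "\<not> bval w init_test s2"
    by blast
  then obtain h where h: "init_state h s2" "h \<le> 2 * m" using I_def by auto
  then have "h = 2 * m" using 2(4) test[OF h(1)] by simp
  then show ?thesis using 2(1,2) h(1) by blast
qed

lemma phase1_exec:
  assumes P: "phase1_state D s"
  shows "\<exists>t s'. exec w (While phase1_test phase1_body) s t s' \<and>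
    t \<le> 8 * m * loop_cost phase1_test phase1_body + 1 + bcost phase1_test \<and>
    phase1_state D s' \<and> regs s' 6 = m"
proof -
  let ?c = "loop_cost phase1_test phase1_body"
  \<comment> \<open>Every iteration lowers the potential by at least one, so potential times
    iteration cost is a sufficient budget.\<close>
  define I where "I = (\<lambda>q s'. phase1_state D s' \<and> q = store_pot s' * ?c)"
  have I0: "I (store_pot s * ?c) s" unfolding I_def using P by simp
  have lf: "loop_free phase1_body"
    by (simp add: phase1_body_def push_com_def decr_com_def remove_com_def)
  have test: "bval w phase1_test s' \<longleftrightarrow> regs s' 6 < m" if "phase1_state D s'" for s'
    using that by (simp add: phase1_test_def phase1_state_def input_def)
  have "\<exists>t s'' q'. exec w phase1_body s' t s'' \<and> I q' s'' \<and> 1 + bcost phase1_test + t + q' \<le> q"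
    if I: "I q s'" and b: "bval w phase1_test s'" for q s'
  proof -
    have h: "phase1_state D s'" "q = store_pot s' * ?c" using I I_def by auto
    have hm: "regs s' 6 < m" using test[OF h(1)] b by simp
    let ?f = "final w phase1_body s'"
    obtain t where "t \<le> max_time phase1_body" "exec w phase1_body s' t ?f"
      using exec_final[OF lf] by blast
    moreover have "I (store_pot ?f * ?c) ?f" unfolding I_def using phase1_step[OF h(1) hm] by simp
    moreover have "Suc (store_pot ?f) * ?c \<le> store_pot s' * ?c"
      using phase1_step[OF h(1) hm] by (intro mult_le_mono1) blast
    ultimately show ?thesis using h(2)
      by (intro exI[of _ t] exI[of _ ?f] exI[of _ "store_pot ?f * ?c"]) simp
  qed
  from exec_While[of I w phase1_test phase1_body, OF this I0]
  obtain t2 s2 q2 where 2: "exec w (While phase1_test phase1_body) s t2 s2"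
    "t2 \<le> store_pot s * ?c + 1 + bcost phase1_test" "I q2 s2" "\<not> bval w phase1_test s2"
    by blast
  have P2: "phase1_state D s2" using 2(3) I_def by simp
  have "\<not> regs s2 6 < m" using test[OF P2] 2(4) by simp
  moreover have "regs s2 6 \<le> m" using P2 by (simp add: phase1_state_def phase1_inv_def)
  moreover have "store_pot s * ?c \<le> 8 * m * ?c"
    using P by (intro mult_le_mono1) (simp add: phase1_state_def)
  ultimately have "regs s2 6 = m" "t2 \<le> 8 * m * ?c + 1 + bcost phase1_test" using 2(2) by linarith+
  then show ?thesis using 2(1) P2 by blast
qed

lemma leaves_exec:
  assumes P: "phase1_state D s" "regs s 6 = m" "regs s 10 = 1" and D: "D \<le> m"
    and H: "H = (LEAST h. 2 * D \<le> 2 ^ h)"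
  shows "\<exists>t s'. exec w (While leaves_test leaves_body) s t s' \<and>
    t \<le> H * loop_cost leaves_test leaves_body + 1 + bcost leaves_test \<and>
    phase1_state D s' \<and> regs s' 6 = m \<and> regs s' 10 = 2 ^ H"
proof -
  let ?c = "loop_cost leaves_test leaves_body"
  \<comment> \<open>The exponent \<open>2 * D\<close> witnesses that the \<open>LEAST\<close> is
    attained.\<close>
  have "2 * D < 2 ^ (2 * D)" by (rule less_exp)
  then have "2 * D \<le> 2 ^ (2 * D)" by simp
  then have DH: "2 * D \<le> 2 ^ H" unfolding H by (rule LeastI)
  define I where "I = (\<lambda>q s'. \<exists>h\<le>H. phase1_state D s' \<and> regs s' 6 = m \<and> regs s' 10 = 2 ^ h \<and> q = (H - h) * ?c)"
  have I0: "I (H * ?c) s" unfolding I_def using P by (intro exI[of _ 0]) simp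
  have lf: "loop_free leaves_body" by (simp add: leaves_body_def)
  have test: "bval w leaves_test s' \<longleftrightarrow> regs s' 10 < 2 * D" if "phase1_state D s'" for s'
    using that D by (simp add: leaves_test_def phase1_state_def)
  have "\<exists>t s'' q'. exec w leaves_body s' t s'' \<and> I q' s'' \<and> 1 + bcost leaves_test + t + q' \<le> q"
    if I: "I q s'" and b: "bval w leaves_test s'" for q s'
  proof -
    obtain h where h: "phase1_state D s'" "regs s' 6 = m" "regs s' 10 = 2 ^ h" "q = (H - h) * ?c" "h \<le> H"
      using I I_def by auto
    have lt: "2 ^ h < 2 * D" using test[OF h(1)] b h(3) by simp
    then have hH: "h < H" using DH h(5) by (cases "h = H") auto
    have fin: "final w leaves_body s' = set_reg 10 (2 ^ Suc h) s'"
      using lt D h(3) by (simp add: leaves_body_def)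
    obtain t where "t \<le> max_time leaves_body" "exec w leaves_body s' t (final w leaves_body s')"
      using exec_final[OF lf] by blast
    moreover have "phase1_state D (final w leaves_body s')"
      using h(1) input_set_reg[of s' 10 "2 ^ Suc h"] unfolding phase1_state_def fin by simp
    then have "I ((H - Suc h) * ?c) (final w leaves_body s')"
      unfolding I_def using h hH by (intro exI[of _ "Suc h"]) (simp add: fin)
    moreover have "(H - h) * ?c = ?c + (H - Suc h) * ?c"
      using hH by (simp add: Suc_diff_Suc[symmetric])
    ultimately show ?thesis using h(4)
      by (intro exI[of _ t] exI[of _ "final w leaves_body s'"] exI[of _ "(H - Suc h) * ?c"]) simp
  qed
  from exec_While[of I w leaves_test leaves_body, OF this I0]
  obtain t2 s2 q2 where 2: "exec w (While leaves_test leaves_body) s t2 s2"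
    "t2 \<le> H * ?c + 1 + bcost leaves_test" "I q2 s2" "\<not> bval w leaves_test s2"
    by blast
  then obtain h where h: "phase1_state D s2" "regs s2 6 = m" "regs s2 10 = 2 ^ h" "h \<le> H"
    using I_def by auto
  have "2 * D \<le> 2 ^ h" using test[OF h(1)] 2(4) h(3) by simp
  then have "H \<le> h" unfolding H by (rule Least_le)
  then have "h = H" using h(4) by simp
  then show ?thesis using 2(1,2) h by blast
qed

lemma init_prep_state: "init_state 0 (final w init_prep (input_store n ps))"
proof -
  let ?s = "input_store n ps"
  have fin: "final w init_prep ?s = set_reg 2 (3 * m) ?s"
    by (simp add: init_prep_def input_store_def m_def[symmetric])
  have arr: "arr m ?s k i j = 0" for k i j
    by (simp add: arr_def input_store_def m_def[symmetric] cell_def)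
  have "vec m ?s k = (\<lambda>_. 0)" for k using arr by (simp add: vec_def fun_eq_iff del: arr_0)
  moreover have "arr m ?s k = (\<lambda>_ _. 0)" for k using arr by (simp add: fun_eq_iff)
  moreover have "mem ?s h = vt h" if "h < 2 * m" for h
    using that by (simp add: input_store_def vt_def m_def)
  moreover have "regs ?s (Suc 0) = m" "regs ?s 3 = 0" "regs ?s 6 = 0" "regs ?s 4 = 0"
    by (simp_all add: input_store_def m_def)
  ultimately show ?thesis
    unfolding fin init_state_def input_def using init_inv_start by simp
qed

lemma program_exec:
  "\<exists>t s H D. exec w program (input_store n ps) t s \<and> cg_returns E (output_coloring ps s) \<and>
     t \<le> time_const * ((1 + m) * (1 + H)) \<and> (H = 0 \<or> 2 ^ H < 4 * D) \<and> D \<le> max_degree {0..<n} E"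
proof -
  let ?s0 = "input_store n ps"
  have ip: "loop_free init_prep" "loop_free phase1_prep" "loop_free leaves_prep"
    by (simp_all add: init_prep_def phase1_prep_def leaves_prep_def)
  obtain t1 where t1: "t1 \<le> max_time init_prep" "exec w init_prep ?s0 t1 (final w init_prep ?s0)"
    using exec_final[OF ip(1)] by blast
  obtain t2 s2 where t2: "exec w (While init_test init_body) (final w init_prep ?s0) t2 s2"
    "t2 \<le> 2 * m * loop_cost init_test init_body + 1 + bcost init_test" "init_state (2 * m) s2"
    using init_exec[OF init_prep_state] by blast
  define D where "D = regs s2 4"
  have inv: "init_inv (2 * m) (vec m s2 0) (arr m s2 8) (vec m s2 2) (vec m s2 3) (arr m s2 4) D"
    using t2(3) by (simp add: init_state_def D_def)
  note start = phase1_start[OF inv]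
  define s3 where "s3 = final w phase1_prep s2"
  have s3: "s3 = set_reg 7 1 s2" by (simp add: s3_def phase1_prep_def)
  obtain t3 where t3: "t3 \<le> max_time phase1_prep" "exec w phase1_prep s2 t3 s3"
    using exec_final[OF ip(2)] unfolding s3_def by blast
  have "input s3" unfolding s3 using t2(3) by (intro input_set_reg) (auto simp: init_state_def)
  then have P3: "phase1_state D s3"
    using start(1,2) t2(3) unfolding phase1_state_def s3 by (simp add: init_state_def D_def)
  obtain t4 s4 where t4: "exec w (While phase1_test phase1_body) s3 t4 s4"
    "t4 \<le> 8 * m * loop_cost phase1_test phase1_body + 1 + bcost phase1_test"
    "phase1_state D s4" "regs s4 6 = m"
    using phase1_exec[OF P3] by blast
  define s5 where "s5 = final w leaves_prep s4"
  have s5: "s5 = set_reg 10 1 s4" by (simp add: s5_def leaves_prep_def)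
  obtain t5 where t5: "t5 \<le> max_time leaves_prep" "exec w leaves_prep s4 t5 s5"
    using exec_final[OF ip(3)] unfolding s5_def by blast
  have "input s5" unfolding s5 using t4(3) by (intro input_set_reg) (auto simp: phase1_state_def)
  then have P5: "phase1_state D s5" "regs s5 6 = m" "regs s5 10 = 1"
    using t4(3,4) unfolding phase1_state_def s5 by simp_all
  have "D = 0 \<or> (\<exists>v<n. degree E v = D)"
  proof -
    have "vec m s2 0 v = degree E v" for v using inv degree_E by (simp add: init_inv_def)
    moreover have "D = 0 \<or> (\<exists>v<n. vec m s2 0 v = D)" using inv unfolding init_inv_def by (elim conjE)
    ultimately show ?thesis by simp
  qed
  then have Dm: "D \<le> m" using degree_le_m[of "{..<m}"] E_eq by auto
  define H where "H = (LEAST h. 2 * D \<le> 2 ^ h)"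
  obtain t6 s6 where t6: "exec w (While leaves_test leaves_body) s5 t6 s6"
    "t6 \<le> H * loop_cost leaves_test leaves_body + 1 + bcost leaves_test"
    "phase1_state D s6" "regs s6 6 = m" "regs s6 10 = 2 ^ H"
    using leaves_exec[OF P5 Dm H_def] by blast
  have "2 * D < 2 ^ (2 * D)" by (rule less_exp)
  then have "2 * D \<le> 2 ^ (2 * D)" by simp
  then have DH: "2 * D \<le> 2 ^ H" unfolding H_def by (rule LeastI)
  \<comment> \<open>By minimality of \<open>H\<close>, half of \<open>2 ^ H\<close> is still below
    \<open>2 * D\<close>.\<close>
  have H4: "H = 0 \<or> 2 ^ H < 4 * D"
  proof (cases H)
    case (Suc h)
    then have "h < (LEAST h. 2 * D \<le> 2 ^ h)" using H_def by simp
    then have "\<not> 2 * D \<le> 2 ^ h" by (rule not_less_Least)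
    then show ?thesis using Suc by simp
  qed simp
  \<comment> \<open>The summand 1 covers \<open>H = 0\<close>, where \<open>2 ^ H = 1\<close> even
    without edges.\<close>
  then have L: "2 ^ H \<le> 4 * m + 1" using Dm by auto
  have P6: "phase2_state H m (\<lambda>e. mem s6 (2 * m + e)) s6"
    using t6 phase2_start[of _ _ _ _ _ _ _ "vec m s6 6" H]
    unfolding phase2_state_def phase1_state_def by auto
  obtain t7 s7 where t7: "exec w (While phase2_test phase2_body) s6 t7 s7"
    "t7 \<le> m * (1 + bcost phase2_test + phase2_cost H) + 1 + bcost phase2_test"
    "cg_returns E (output_coloring ps s7)"
    using phase2_exec[OF P6 start(4) DH L] by blast
  have "exec w program ?s0 (t1 + (t2 + (t3 + (t4 + (t5 + (t6 + t7)))))) s7"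
    unfolding program_def
    by (rule exec.Seq[OF t1(2) exec.Seq[OF t2(1) exec.Seq[OF t3(2) exec.Seq[OF t4(1)
       exec.Seq[OF t5(2) exec.Seq[OF t6(1) t7(1)]]]]]])
  moreover have "t1 + (t2 + (t3 + (t4 + (t5 + (t6 + t7))))) \<le> time_const * ((1 + m) * (1 + H))"
  proof -
    let ?z = "(1 + m) * (1 + H)"
    \<comment> \<open>The monomials 1, \<open>m\<close>, \<open>H\<close> and \<open>m * H\<close>
      are all bounded by one product, so their coefficients may simply be added.\<close>
    have z: "1 \<le> ?z" "m \<le> ?z" "H \<le> ?z" "m * H \<le> ?z" by (simp_all add: algebra_simps)
    have z1: "a \<le> a * ?z" "a * m \<le> a * ?z" "a * H \<le> a * ?z" "a * (m * H) \<le> a * ?z" for a :: nat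
      using mult_le_mono2[OF z(1), of a] mult_le_mono2[OF z(2), of a] mult_le_mono2[OF z(3), of a]
        mult_le_mono2[OF z(4), of a] by simp_all
    define a0 where "a0 = max_time init_prep + 1 + bcost init_test + max_time phase1_prep
      + 1 + bcost phase1_test + max_time leaves_prep + 1 + bcost leaves_test + 1 + bcost phase2_test"
    define a1 where "a1 = 2 * (1 + bcost init_test + max_time init_body)
      + 8 * (1 + bcost phase1_test + max_time phase1_body)
      + (1 + bcost phase2_test + max_time search_prep + 1 + bcost search_test + max_time color_com)"
    define a2 where "a2 = 1 + bcost leaves_test + max_time leaves_body"
    define a3 where "a3 = 1 + bcost search_test + max_time search_body"
    have "t1 + (t2 + (t3 + (t4 + (t5 + (t6 + t7))))) \<le> a0 + a1 * m + a2 * H + a3 * (m * H)"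
      using t1(1) t2(2) t3(1) t4(2) t5(1) t6(2) t7(2)
      unfolding a0_def a1_def a2_def a3_def phase2_cost_def by (simp add: algebra_simps)
    also have "\<dots> \<le> a0 * ?z + a1 * ?z + a2 * ?z + a3 * ?z"
      by (intro add_mono z1)
    also have "\<dots> = (a0 + a1 + a2 + a3) * ?z" by (simp only: add_mult_distrib)
    also have "a0 + a1 + a2 + a3 = time_const"
      by (simp add: a0_def a1_def a2_def a3_def time_const_def)
    finally show ?thesis .
  qed
  ultimately show ?thesis using t7(3) H4 start(3) by blast
qed

end

section \<open>The final bound\<close>

text \<open>For the logarithm \<open>?l\<close> the first assumption gives \<open>H\<close> < 2 +
  \<open>?l\<close> unless \<open>H = 0\<close>. Since \<open>?l\<close> is at least 1 owing to the
  \<open>max 2\<close>, 3 + \<open>?l\<close> is at most four times \<open>?l\<close>.\<close>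

lemma heap_height_le_log:
  assumes "H = 0 \<or> 2 ^ H < 4 * D" "D \<le> \<Delta>"
  shows "1 + real H \<le> 4 * log 2 (real (max 2 \<Delta>))"
proof -
  let ?l = "log 2 (real (max 2 \<Delta>))"
  have l: "1 \<le> ?l" by (simp add: le_log_iff)
  show ?thesis
  proof (cases "H = 0")
    case False
    then have "2 ^ H < 4 * D" using assms(1) by simp
    also have "\<dots> \<le> 4 * max 2 \<Delta>" using assms(2) by simp
    finally have "real (2 ^ H) < real (4 * max 2 \<Delta>)" by (simp only: of_nat_less_iff)
    then have "2 powr real H < 4 * real (max 2 \<Delta>)" by (simp add: powr_realpow)
    then have "real H < log 2 (4 * real (max 2 \<Delta>))" by (simp add: less_log_iff)
    also have "\<dots> = log 2 (2 ^ 2) + ?l" by (subst log_mult) auto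
    also have "log 2 (2 ^ 2 :: real) = 2" by (subst log_nat_power) auto
    finally show ?thesis using l by linarith
  qed (use l in linarith)
qed

theorem theoremA1:
  shows "(\<forall>(V :: 'a set) E. simple_graph V E \<longrightarrow>
            cg_always_returns E \<and>
            (\<forall>\<chi>. cg_returns E \<chi> \<longrightarrow>
              proper_edge_coloring (max_degree V E + 2 * arboricity V E - 1) E \<chi>))
       \<and> (\<exists>(P :: com) (C :: real) (k :: nat). \<forall>n ps w.
            edge_list n ps \<longrightarrow> (n + length ps + 2) ^ k \<le> 2 ^ w \<longrightarrow>
            (\<exists>t s. exec w P (input_store n ps) t s
               \<and> (\<forall>t' s'. exec w P (input_store n ps) t' s' \<longrightarrow> t' = t \<and> s' = s)
               \<and> cg_returns (edges_of ps) (output_coloring ps s)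
               \<and> real t \<le> C * real (max 1 (length ps))
                     * (log 2 (real (max 2 (max_degree {0..<n} (edges_of ps)))))\<^sup>2))"
proof (rule conjI, intro allI impI conjI)
  fix V :: "'a set" and E assume G: "simple_graph V E"
  show "cg_always_returns E" using cg_always_returns[OF G] .
  show "proper_edge_coloring (max_degree V E + 2 * arboricity V E - 1) E \<chi>" if "cg_returns E \<chi>" for \<chi>
    using cg_returns_proper[OF G that] .
next
  show "\<exists>(P :: com) (C :: real) (k :: nat). \<forall>n ps w.
            edge_list n ps \<longrightarrow> (n + length ps + 2) ^ k \<le> 2 ^ w \<longrightarrow>
            (\<exists>t s. exec w P (input_store n ps) t s
               \<and> (\<forall>t' s'. exec w P (input_store n ps) t' s' \<longrightarrow> t' = t \<and> s' = s)
               \<and> cg_returns (edges_of ps) (output_coloring ps s)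
               \<and> real t \<le> C * real (max 1 (length ps))
                     * (log 2 (real (max 2 (max_degree {0..<n} (edges_of ps)))))\<^sup>2)"
  proof (rule exI[of _ program], rule exI[of _ "8 * real time_const"], rule exI[of _ 16],
      intro allI impI)
    fix n ps w assume "edge_list n ps" "(n + length ps + 2) ^ 16 \<le> (2::nat) ^ w"
    then interpret word_ram n ps w by unfold_locales
    let ?\<Delta> = "max_degree {0..<n} (edges_of ps)"
    let ?l = "log 2 (real (max 2 ?\<Delta>))" and ?M = "real (max 1 (length ps))"
    obtain t s H D where e: "exec w program (input_store n ps) t s"
      "cg_returns (edges_of ps) (output_coloring ps s)"
      "t \<le> time_const * ((1 + m) * (1 + H))" "H = 0 \<or> 2 ^ H < 4 * D" "D \<le> ?\<Delta>"
      using program_exec by blast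
    have l: "1 \<le> ?l" by (simp add: le_log_iff)
    have "real t \<le> real (time_const * ((1 + m) * (1 + H)))" using e(3) by (simp only: of_nat_le_iff)
    also have "\<dots> = real time_const * ((1 + real m) * (1 + real H))" by (simp only: of_nat_mult of_nat_add of_nat_1)
    \<comment> \<open>The factor 8 arises here: \<open>1 + m\<close> is at most twice
      \<open>?M\<close>, and the height contributes the factor 4.\<close>
    also have "\<dots> \<le> real time_const * ((2 * ?M) * (4 * ?l))"
      using heap_height_le_log[OF e(4,5)] by (intro mult_left_mono mult_mono) (auto simp: m_def)
    also have "\<dots> = 8 * real time_const * ?M * ?l" by simp
    \<comment> \<open>A single logarithm suffices; as it is at least 1, squaring it only weakens the
      bound.\<close>
    also have "\<dots> \<le> 8 * real time_const * ?M * ?l\<^sup>2"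
      using self_le_power[OF l, of 2] by (intro mult_left_mono) auto
    finally show "\<exists>t s. exec w program (input_store n ps) t s
                 \<and> (\<forall>t' s'. exec w program (input_store n ps) t' s' \<longrightarrow> t' = t \<and> s' = s)
                 \<and> cg_returns (edges_of ps) (output_coloring ps s)
                 \<and> real t \<le> 8 * real time_const * ?M * ?l\<^sup>2"
      using e(1,2) exec_deterministic[OF e(1)] by blast
  qed
qed

end
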